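(* Let $A$ be a finite-dimensional associative algebra over $\mathbb C$ with a basis $\{a_1,\dots,a_n\}$, and let $d>2$ be even. Then the polynomial $\det_d(C^A(x))$ is not identically zero if and only if $A$ is semisimple (equivalently, $\det_d(C^A(x))\equiv0$ if and only if the Jacobson radical $J(A)$ is nonzero).
   Context: Write $a_{i_1}\cdots a_{i_d}=\sum_k\mu^k_{i_1,\dots,i_d}a_k$ and let $x_1,\dots,x_n$ be commuting indeterminates. The algebra tensor is the $n\times\cdots\times n$ ($d$ modes) hypermatrix $C^A(x)_{i_1,\dots,i_d}=\sum_k\mu^k_{i_1,\dots,i_d}x_k$. The combinatorial hyperdeterminant is $\det_d(X)=\frac1{n!}\sum_{\sigma_1,\dots,\sigma_d\in S_n}\mathrm{sgn}(\sigma_1)\cdots\mathrm{sgn}(\sigma_d)\prod_{i=1}^n X_{\sigma_1(i),\dots,\sigma_d(i)}$. *)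

theory Defs
  imports
    Complex_Main
    "HOL-Library.FuncSet"
    "HOL-Library.Poly_Mapping"
    "HOL-Combinatorics.Permutations"
begin

text \<open>
  Polynomials over the complex numbers in commuting indeterminates \<open>x\<^sub>k\<close> (\<open>k\<close> a natural number):
  finitely supported maps from exponent vectors to coefficients, multiplied by convolution.
\<close>

type_synonym cpoly = "(nat \<Rightarrow>\<^sub>0 nat) \<Rightarrow>\<^sub>0 complex"

definition Const :: "complex \<Rightarrow> cpoly"
  where "Const c = Poly_Mapping.single 0 c"

definition X :: "nat \<Rightarrow> cpoly"
  where "X k = Poly_Mapping.single (Poly_Mapping.single k 1) 1"

text \<open>
  A hypermatrix with \<open>d\<close> modes of size \<open>n\<close> is a function on index lists of length \<open>d\<close> with entries
  in \<open>{1..n}\<close>; values at other lists are never used.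
\<close>

definition hyperdet :: "nat \<Rightarrow> nat \<Rightarrow> (nat list \<Rightarrow> cpoly) \<Rightarrow> cpoly"
  where "hyperdet d n M =
    Const (1 / fact n) *
    (\<Sum>\<sigma> \<in> {1..d} \<rightarrow>\<^sub>E {p. p permutes {1..n}}.
       (\<Prod>j=1..d. of_int (sign (\<sigma> j))) *
       (\<Prod>i=1..n. M (map (\<lambda>j. \<sigma> j i) [1..<Suc d])))"

text \<open>Product of a nonempty list; there is no unit to start from.\<close>

definition list_product :: "'a::ring list \<Rightarrow> 'a"
  where "list_product xs = foldl (*) (hd xs) (tl xs)"

text \<open>Associative algebras are not assumed to have a unit: the class \<^class>\<open>ring\<close> does not provide one.\<close>

locale complex_algebra = vector_space scale
  for scale :: "complex \<Rightarrow> 'a::ring \<Rightarrow> 'a" +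
  assumes scale_mult_left: "scale c x * y = scale c (x * y)"
    and scale_mult_right: "x * scale c y = scale c (x * y)"
begin

definition left_ideal :: "'a set \<Rightarrow> bool"
  where "left_ideal L \<longleftrightarrow> subspace L \<and> (\<forall>x. \<forall>y\<in>L. x * y \<in> L)"

definition simple_left_ideal :: "'a set \<Rightarrow> bool"
  where "simple_left_ideal L \<longleftrightarrow>
    left_ideal L \<and> L \<noteq> {0} \<and> (\<forall>K. left_ideal K \<and> K \<subseteq> L \<longrightarrow> K = {0} \<or> K = L)"

text \<open>
  A semisimple algebra is a unital algebra whose left regular module is a direct sum of simple
  modules. The direct sum is internal, and finite because algebras here have finite dimension.
  The zero algebra, whose unit is 0, is the empty direct sum.
\<close>

definition semisimple :: bool
  where "semisimple \<longleftrightarrow>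
    (\<exists>e::'a. \<forall>x. e * x = x \<and> x * e = x) \<and>
    (\<exists>m::nat. \<exists>L. (\<forall>i<m. simple_left_ideal (L i)) \<and>
       (\<forall>x. \<exists>!c. c \<in> (\<Pi>\<^sub>E i\<in>{..<m}. L i) \<and> x = (\<Sum>i<m. c i)))"

definition maximal_left_ideal :: "'a set \<Rightarrow> bool"
  where "maximal_left_ideal L \<longleftrightarrow>
    left_ideal L \<and> L \<noteq> UNIV \<and> (\<forall>K. left_ideal K \<and> L \<subseteq> K \<longrightarrow> K = L \<or> K = UNIV)"

text \<open>Modularity (regularity) of a left ideal holds automatically when the algebra has a unit.\<close>

definition modular_left_ideal :: "'a set \<Rightarrow> bool"
  where "modular_left_ideal L \<longleftrightarrow> left_ideal L \<and> (\<exists>e. \<forall>x. x - x * e \<in> L)"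

text \<open>
  The Jacobson radical of a possibly non-unital algebra; it is the whole algebra if there are no
  modular maximal left ideals.
\<close>

definition jacobson_radical :: "'a set"
  where "jacobson_radical = \<Inter> {L. maximal_left_ideal L \<and> modular_left_ideal L}"

lemma modular_left_ideal_unital:
  assumes "\<And>x::'a. x * e = x" and "left_ideal L"
  shows "modular_left_ideal L"
proof -
  have "\<forall>x. x - x * e \<in> L"
    using assms by (simp add: left_ideal_def subspace_0)
  then show ?thesis
    using assms(2) unfolding modular_left_ideal_def by blast
qed

end

locale complex_algebra_with_basis = complex_algebra scale
  for scale :: "complex \<Rightarrow> 'a::ring \<Rightarrow> 'a" +
  fixes n :: nat and a :: "nat \<Rightarrow> 'a"
  assumes inj_basis: "inj_on a {1..n}"
    and independent_basis: "independent (a ` {1..n})"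
    and span_basis: "span (a ` {1..n}) = UNIV"
begin

text \<open>The coefficient of \<open>a\<^sub>k\<close> in the product of the basis elements indexed by the list \<open>I\<close>.\<close>

definition structure_constant :: "nat list \<Rightarrow> nat \<Rightarrow> complex"
  where "structure_constant I k = representation (a ` {1..n}) (list_product (map a I)) (a k)"

lemma list_product_basis:
  "list_product (map a I) = (\<Sum>k=1..n. scale (structure_constant I k) (a k))"
proof -
  let ?v = "list_product (map a I)"
  have "?v = (\<Sum>b\<in>a ` {1..n}. scale (representation (a ` {1..n}) ?v b) b)"
    using independent_basis span_basis by (intro sum_representation_eq[symmetric]) simp_all
  also have "\<dots> = (\<Sum>k=1..n. scale (structure_constant I k) (a k))"
    using inj_basis by (simp add: sum.reindex structure_constant_def)
  finally show ?thesis .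
qed

definition algebra_tensor :: "nat list \<Rightarrow> cpoly"
  where "algebra_tensor I = (\<Sum>k=1..n. Const (structure_constant I k) * X k)"

end

end

theory Submission
  imports
    Defs
    "HOL-Computational_Algebra.Fundamental_Theorem_Algebra"
begin

text \<open>
  Evaluating the indeterminates amounts to choosing a linear functional \<open>l\<close> on \<open>A\<close>; the hyperdeterminant
  then becomes an alternating sum of products of values \<open>l (a\<^bsub>i\<^sub>1\<^esub> \<cdots> a\<^bsub>i\<^sub>d\<^esub>)\<close> which, up to a factor,
  does not change when the basis is replaced in any single mode. The dichotomy is whether \<open>A\<close> has a
  nonzero two-sided ideal \<open>I\<close> with \<open>I I = 0\<close>.

  If it does, use a basis adapted to \<open>I\<close> in the first two modes, and let \<open>r\<close> be the dimension of \<open>I\<close>.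
  In each term either both of the first two entries of some factor lie in \<open>I\<close>, and this factor
  vanishes, or \<open>2 r\<close> of the functionals obtained from the first \<open>d - 1\<close> entries have the form
  \<open>x \<mapsto> l (y x)\<close> with \<open>y \<in> I\<close>. As \<open>2 r > r\<close>, they are dependent, so alternating over the last mode
  gives 0. This uses \<open>d > 2\<close>.

  If it does not, minimal left ideals are generated by primitive idempotents, the algebra is unital,
  and it has a basis of matrix units \<open>E\<^sub>i\<^sub>j\<close>, where \<open>(i, j)\<close> runs through an equivalence relation. For the
  functional sending \<open>E\<^sub>i\<^sub>j\<close> to \<open>\<delta>\<^sub>i\<^sub>j\<close>, cutting a product of length \<open>2 h\<close> in the middle and transposing
  the second half writes the alternating sum as plus or minus the sum of the squares of the real
  numbers \<open>G\<^sub>h(m)\<close>, the alternating sums for products of length \<open>h\<close> with prescribed values \<open>m\<close>. These are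
  not all zero by induction: \<open>G\<^sub>h\<close> determines the sum of even length \<open>h\<close> or \<open>h + 1\<close>.
\<close>

section \<open>Alternating sums over permutations of families\<close>

text \<open>
  One permutation is drawn for each family, and \<open>\<Phi>\<close> is applied to the permuted families. Recursion along
  the list makes splitting and reversing the modes structural.
\<close>

primrec altsum :: "'i set \<Rightarrow> ('i \<Rightarrow> 'b) list \<Rightarrow> (('i \<Rightarrow> 'b) list \<Rightarrow> 'c::comm_ring_1) \<Rightarrow> 'c"
  where
    "altsum S [] \<Phi> = \<Phi> []"
  | "altsum S (v # vs) \<Phi> =
       (\<Sum>s | s permutes S. of_int (sign s) * altsum S vs (\<lambda>ws. \<Phi> ((v \<circ> s) # ws)))"

text \<open>Only rearrangements of the given families by permutations of \<open>S\<close> reach the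
  integrand, so agreement on these lists suffices. Later uses need this restriction.\<close>

lemma altsum_cong:
  assumes "\<And>ws. list_all2 (\<lambda>w v. \<exists>s. s permutes S \<and> w = v \<circ> s) ws vs \<Longrightarrow> \<Phi> ws = \<Psi> ws"
  shows "altsum S vs \<Phi> = altsum S vs \<Psi>"
  using assms
proof (induction vs arbitrary: \<Phi> \<Psi>)
  case (Cons v vs)
  have "altsum S vs (\<lambda>ws. \<Phi> ((v \<circ> s) # ws)) = altsum S vs (\<lambda>ws. \<Psi> ((v \<circ> s) # ws))"
    if "s permutes S" for s
    by (rule Cons.IH, rule Cons.prems) (unfold list_all2_Cons, use that in blast)
  then show ?case by (auto intro: sum.cong)
qed simp

lemma altsum_append:
  "altsum S (us @ vs) \<Phi> = altsum S us (\<lambda>ws. altsum S vs (\<lambda>zs. \<Phi> (ws @ zs)))"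
  by (induction us arbitrary: \<Phi>) simp_all

lemma altsum_sum: "altsum S vs (\<lambda>ws. \<Sum>k\<in>K. \<Phi> k ws) = (\<Sum>k\<in>K. altsum S vs (\<Phi> k))"
proof (induction vs arbitrary: \<Phi>)
  case (Cons v vs)
  show ?case
    by (simp add: Cons.IH sum_distrib_left sum.swap[of _ K])
qed simp

lemma altsum_mult: "altsum S vs (\<lambda>ws. c * \<Phi> ws) = c * altsum S vs \<Phi>"
  by (induction vs arbitrary: \<Phi>) (simp_all add: sum_distrib_left mult.left_commute)

lemma altsum_mult_right: "altsum S vs (\<lambda>ws. \<Phi> ws * c) = altsum S vs \<Phi> * c"
  using altsum_mult[of S vs c \<Phi>] by (simp add: mult.commute)

lemma altsum_zero [simp]: "altsum S vs (\<lambda>_. 0) = 0"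
  by (induction vs) simp_all

lemma altsum_snoc:
  "altsum S (vs @ [v]) \<Phi> =
     (\<Sum>s | s permutes S. of_int (sign s) * altsum S vs (\<lambda>ws. \<Phi> (ws @ [v \<circ> s])))"
  by (simp add: altsum_append altsum_sum altsum_mult)

text \<open>The modes are summed independently, so their order is immaterial. This absorbs the
  reversal of products caused by transposition.\<close>

lemma altsum_rev: "altsum S (rev vs) \<Phi> = altsum S vs (\<lambda>ws. \<Phi> (rev ws))"
  by (induction vs arbitrary: \<Phi>) (simp_all add: altsum_snoc)

lemma altsum_map:
  "altsum S (map ((\<circ>) g) vs) \<Phi> = altsum S vs (\<lambda>ws. \<Phi> (map ((\<circ>) g) ws))"
  by (induction vs arbitrary: \<Phi>) (simp_all add: comp_assoc)

text \<open>Used for the evaluation of polynomials and for the embedding of the reals into the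
  complex numbers.\<close>

lemma altsum_hom:
  fixes h :: "'c::comm_ring_1 \<Rightarrow> 'd::comm_ring_1"
  assumes add: "\<And>x y. h (x + y) = h x + h y" and mult: "\<And>x y. h (x * y) = h x * h y"
    and one: "h 1 = 1"
  shows "h (altsum S vs \<Phi>) = altsum S vs (\<lambda>ws. h (\<Phi> ws))"
proof -
  have zero: "h 0 = 0"
    using add[of 0 0] by simp
  have uminus: "h (- x) = - h x" for x
    using add[of x "- x"] zero by (simp add: eq_neg_iff_add_eq_0 add.commute)
  have sgn: "h (of_int (sign s)) = of_int (sign s)" for s :: "'i \<Rightarrow> 'i"
    by (simp add: sign_def one uminus)
  have sum: "h (sum f K) = (\<Sum>k\<in>K. h (f k))" for f :: "('i \<Rightarrow> 'i) \<Rightarrow> 'c" and K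
    by (induction K rule: infinite_finite_induct) (simp_all add: zero add)
  show ?thesis
    by (induction vs arbitrary: \<Phi>) (simp_all add: sum mult sgn)
qed

text \<open>Substituting \<open>p \<circ> s\<close> for \<open>s\<close> contributes one factor
  \<open>sign p\<close> in each of the \<open>h\<close> modes.\<close>

lemma altsum_replicate_comp_permutation:
  fixes \<Phi> :: "('i \<Rightarrow> 'b) list \<Rightarrow> 'c::comm_ring_1"
  assumes "finite S" and p: "p permutes S"
  shows "altsum S (replicate h (v \<circ> p)) \<Phi> = of_int (sign p) ^ h * altsum S (replicate h v) \<Phi>"
proof (induction h arbitrary: \<Phi>)
  case (Suc h)
  have "(\<Sum>s | s permutes S. of_int (sign s) * altsum S (replicate h v) (\<lambda>ws. \<Phi> ((v \<circ> s) # ws))) =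
      (\<Sum>s | s permutes S. of_int (sign (p \<circ> s)) *
         altsum S (replicate h v) (\<lambda>ws. \<Phi> ((v \<circ> (p \<circ> s)) # ws)))"
    by (rule sum.reindex_bij_witness[where i = "\<lambda>s. p \<circ> s" and j = "\<lambda>s. inv p \<circ> s"])
       (use p in \<open>auto simp: comp_assoc[symmetric] permutes_inv_o permutes_compose permutes_inv\<close>)
  moreover have "sign (p \<circ> s) = sign p * sign s" if "s permutes S" for s
    using assms that by (auto intro: sign_compose permutes_imp_permutation)
  ultimately have *: "(\<Sum>s | s permutes S. of_int (sign s) * altsum S (replicate h v) (\<lambda>ws. \<Phi> ((v \<circ> s) # ws))) =
      (\<Sum>s | s permutes S. of_int (sign p) * (of_int (sign s) *
         altsum S (replicate h v) (\<lambda>ws. \<Phi> ((v \<circ> p \<circ> s) # ws))))"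
    by (simp add: comp_assoc mult.assoc)
  have sq: "of_int (sign p) * of_int (sign p) = (1 :: 'c)"
    by (simp add: sign_def)
  have "of_int (sign p) ^ Suc h * altsum S (replicate (Suc h) v) \<Phi> =
     of_int (sign p) * of_int (sign p) * of_int (sign p) ^ h * (\<Sum>s | s permutes S. of_int (sign s) *
         altsum S (replicate h v) (\<lambda>ws. \<Phi> ((v \<circ> p \<circ> s) # ws)))"
    using * by (simp add: sum_distrib_left mult_ac)
  also have "\<dots> = (\<Sum>s | s permutes S. of_int (sign s) * (of_int (sign p) ^ h *
         altsum S (replicate h v) (\<lambda>ws. \<Phi> ((v \<circ> p \<circ> s) # ws))))"
    by (simp only: sq mult_1 sum_distrib_left mult.left_commute)
  also have "\<dots> = altsum S (replicate (Suc h) (v \<circ> p)) \<Phi>"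
    by (simp only: Suc.IH replicate_Suc altsum.simps)
  finally show ?case ..
qed simp

text \<open>Links the hyperdeterminant, indexed by functions on modes, to the recursion along lists.
  The induction peels off the first mode, so the starting index \<open>k\<close> has to be
  arbitrary.\<close>

lemma altsum_replicate_id_eq_sum_PiE:
  fixes g :: "('i \<Rightarrow> 'i) list \<Rightarrow> 'c::comm_ring_1"
  shows
  "(\<Sum>\<sigma> \<in> {k..<k + d} \<rightarrow>\<^sub>E {p. p permutes S}.
      (\<Prod>j=k..<k + d. of_int (sign (\<sigma> j))) * g (map \<sigma> [k..<k + d])) = altsum S (replicate d id) g"
proof (induction d arbitrary: k g)
  case (Suc d)
  let ?P = "{p. p permutes S}"
  have ins: "{k..<k + Suc d} = insert k {Suc k..<Suc k + d}" "[k..<k + Suc d] = k # [Suc k..<Suc k + d]"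
    by (auto simp: upt_rec)
  have inj: "inj_on (\<lambda>(y, g). g(k := y)) (?P \<times> ({Suc k..<Suc k + d} \<rightarrow>\<^sub>E ?P))"
    by (rule inj_combinator) simp
  have pr: "(\<Prod>j=Suc k..<Suc k + d. of_int (sign ((\<sigma>(k := s)) j))) = (\<Prod>j=Suc k..<Suc k + d. of_int (sign (\<sigma> j)) :: 'c)"
    for \<sigma> s by (rule prod.cong) auto
  have mp: "map (\<sigma>(k := s)) [Suc k..<Suc k + d] = map \<sigma> [Suc k..<Suc k + d]" for \<sigma> s
    by auto
  have "(\<Sum>\<sigma> \<in> {k..<k + Suc d} \<rightarrow>\<^sub>E ?P.
      (\<Prod>j=k..<k + Suc d. of_int (sign (\<sigma> j))) * g (map \<sigma> [k..<k + Suc d])) =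
     (\<Sum>(s, \<sigma>) \<in> ?P \<times> ({Suc k..<Suc k + d} \<rightarrow>\<^sub>E ?P).
      of_int (sign s) * ((\<Prod>j=Suc k..<Suc k + d. of_int (sign (\<sigma> j))) * g (s # map \<sigma> [Suc k..<Suc k + d])))"
    unfolding ins PiE_insert_eq sum.reindex[OF inj] o_def case_prod_beta
    by (rule sum.cong) (auto simp: mult.assoc pr mp simp del: upt_Suc)
  also have "\<dots> = (\<Sum>s\<in>?P. of_int (sign s) * altsum S (replicate d id) (\<lambda>ws. g (s # ws)))"
    by (simp only: sum.cartesian_product[symmetric] sum_distrib_left[symmetric]
        Suc.IH[of "Suc k" "\<lambda>ws. g (_ # ws)"])
  finally show ?case by (simp only: replicate_Suc altsum.simps id_comp)
qed simp

lemma hyperdet_eq_altsum: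
  "hyperdet d n M = Const (1 / fact n) *
     altsum {1..n} (replicate d id) (\<lambda>ws. \<Prod>i=1..n. M (map (\<lambda>w. w i) ws))"
proof -
  have e: "{1..d} = {1..<1 + d}" "[1..<Suc d] = [1..<1 + d]" by auto
  show ?thesis
    unfolding hyperdet_def e
    by (subst altsum_replicate_id_eq_sum_PiE[symmetric, where k = 1]) (simp add: comp_def)
qed

section \<open>Determinant-like sums over a single permutation\<close>

lemma alternating_sum_equal_rows:
  fixes f :: "'i \<Rightarrow> 'j \<Rightarrow> 'c::field_char_0" and v :: "'i \<Rightarrow> 'j"
  assumes S: "finite S" and p: "p \<in> S" "q \<in> S" "p \<noteq> q" and f: "f p = f q"
  shows "(\<Sum>s | s permutes S. of_int (sign s) * (\<Prod>i\<in>S. f i (v (s i)))) = 0" (is "?A = 0")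
proof -
  let ?t = "transpose p q"
  have t: "?t permutes S"
    using p by (simp add: permutes_swap_id)
  \<comment> \<open>Composing with the transposition of the two equal rows keeps every product and
    flips every sign.\<close>
  have "?A = (\<Sum>s | s permutes S. of_int (sign (s \<circ> ?t)) * (\<Prod>i\<in>S. f i (v ((s \<circ> ?t) i))))"
    by (rule sum_permutations_compose_right[OF t])
  also have "\<dots> = (\<Sum>s | s permutes S. - (of_int (sign s) * (\<Prod>i\<in>S. f i (v (s i)))))"
  proof (rule sum.cong[OF refl], clarsimp)
    fix s assume s: "s permutes S"
    have "sign (s \<circ> ?t) = - sign s"
      using S s t p by (subst sign_compose) (auto simp: sign_swap_id intro: permutes_imp_permutation)
    moreover have "(\<Prod>i\<in>S. f i (v (s (?t i)))) = (\<Prod>i\<in>S. f (?t i) (v (s (?t i))))"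
      by (rule prod.cong) (auto simp: transpose_def f)
    moreover have "\<dots> = (\<Prod>i\<in>S. f i (v (s i)))"
      by (rule prod.reindex_bij_betw[OF permutes_imp_bij[OF t], of "\<lambda>i. f i (v (s i))"])
    ultimately show "of_int (sign (s \<circ> ?t)) * (\<Prod>i\<in>S. f i (v (s (?t i)))) =
        - (of_int (sign s) * (\<Prod>i\<in>S. f i (v (s i))))" by simp
  qed
  finally have "?A = - ?A" by (simp add: sum_negf)
  then show ?thesis by simp
qed

text \<open>The relation is solved for row \<open>k\<close>. Linearity in that row leaves sums in
  which rows \<open>k\<close> and \<open>j\<close> coincide, and these vanish.\<close>

lemma alternating_sum_dependent_rows:
  fixes f :: "'i \<Rightarrow> 'j \<Rightarrow> 'c::field_char_0" and v :: "'i \<Rightarrow> 'j"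
  assumes S: "finite S" and K: "K \<subseteq> S" "k \<in> K" "c k \<noteq> 0"
    and dep: "\<And>x. (\<Sum>i\<in>K. c i * f i x) = 0"
  shows "(\<Sum>s | s permutes S. of_int (sign s) * (\<Prod>i\<in>S. f i (v (s i)))) = 0"
proof -
  have fK: "finite K" using K S finite_subset by blast
  have fk: "f k x = (\<Sum>i\<in>K - {k}. - (c i / c k) * f i x)" for x
  proof -
    have "c k * f k x + (\<Sum>i\<in>K - {k}. c i * f i x) = 0"
      using dep[of x] fK K by (simp add: sum.remove)
    then have "f k x = - (\<Sum>i\<in>K - {k}. c i * f i x) / c k"
      using K by (simp add: field_simps eq_neg_iff_add_eq_0)
    then show ?thesis
      by (simp add: sum_divide_distrib sum_negf)
  qed
  have "(\<Prod>i\<in>S. f i (v (s i))) =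
      (\<Sum>j\<in>K - {k}. - (c j / c k) * (\<Prod>i\<in>S. (f(k := f j)) i (v (s i))))" for s
  proof -
    have "k \<in> S" using K by blast
    have "(\<Prod>i\<in>S. f i (v (s i))) = f k (v (s k)) * (\<Prod>i\<in>S - {k}. f i (v (s i)))"
      using S \<open>k \<in> S\<close> by (simp add: prod.remove)
    also have "\<dots> = (\<Sum>j\<in>K - {k}. - (c j / c k) * (f j (v (s k)) * (\<Prod>i\<in>S - {k}. f i (v (s i)))))"
      unfolding fk by (simp add: sum_distrib_right mult.assoc)
    also have "\<dots> = (\<Sum>j\<in>K - {k}. - (c j / c k) * (\<Prod>i\<in>S. (f(k := f j)) i (v (s i))))"
      using S \<open>k \<in> S\<close> by (intro sum.cong refl) (simp add: prod.remove[of S k])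
    finally show ?thesis .
  qed
  then have "(\<Sum>s | s permutes S. of_int (sign s) * (\<Prod>i\<in>S. f i (v (s i)))) =
    (\<Sum>s | s permutes S. \<Sum>j\<in>K - {k}. - (c j / c k) *
        (of_int (sign s) * (\<Prod>i\<in>S. (f(k := f j)) i (v (s i)))))"
    by (simp add: sum_distrib_left mult_ac)
  also have "\<dots> = (\<Sum>j\<in>K - {k}. - (c j / c k) * (\<Sum>s | s permutes S.
        of_int (sign s) * (\<Prod>i\<in>S. (f(k := f j)) i (v (s i)))))"
    by (subst sum.swap) (simp only: sum_distrib_left)
  also have "\<dots> = 0"
  proof (rule sum.neutral, rule ballI)
    fix j assume j: "j \<in> K - {k}"
    have "(\<Sum>s | s permutes S. of_int (sign s) * (\<Prod>i\<in>S. (f(k := f j)) i (v (s i)))) = 0"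
      by (rule alternating_sum_equal_rows[of S k j]) (use S K j in auto)
    then show "- (c j / c k) * (\<Sum>s | s permutes S.
        of_int (sign s) * (\<Prod>i\<in>S. (f(k := f j)) i (v (s i)))) = 0" by simp
  qed
  finally show ?thesis .
qed

text \<open>Multiplicativity of the determinant. One factor serves every \<open>f\<close>, which
  later allows it to be pulled out of the sums over the other modes.\<close>

lemma alternating_sum_change_basis:
  fixes P :: "'i \<Rightarrow> 'i \<Rightarrow> 'c::field_char_0"
  assumes S: "finite S"
  shows "\<exists>c. \<forall>f. (\<Sum>s | s permutes S. of_int (sign s) * (\<Prod>i\<in>S. \<Sum>k\<in>S. P (s i) k * f i k)) =
           c * (\<Sum>s | s permutes S. of_int (sign s) * (\<Prod>i\<in>S. f i (s i)))"
proof (intro exI allI)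
  fix f :: "'i \<Rightarrow> 'i \<Rightarrow> 'c"
  let ?Q = "{p. p permutes S}"
  \<comment> \<open>The witness: the determinant of \<open>P\<close> on \<open>S\<close>.\<close>
  define c where "c = (\<Sum>s\<in>?Q. of_int (sign s) * (\<Prod>i\<in>S. P (s i) i))"
  \<comment> \<open>The determinant of \<open>P\<close> with columns selected by
    \<open>\<kappa>\<close>: zero if a column repeats, and \<open>c\<close> up to sign if
    \<open>\<kappa>\<close> is a permutation.\<close>
  define C where "C \<kappa> = (\<Sum>s\<in>?Q. of_int (sign s) * (\<Prod>i\<in>S. P (s i) (\<kappa> i)))" for \<kappa>
  have perm: "C \<kappa> = of_int (sign \<kappa>) * c" if k: "\<kappa> permutes S" for \<kappa>
  proof -
    have "C \<kappa> = (\<Sum>s\<in>?Q. of_int (sign (s \<circ> \<kappa>)) * (\<Prod>i\<in>S. P ((s \<circ> \<kappa>) i) (\<kappa> i)))"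
      unfolding C_def by (rule sum_permutations_compose_right[OF k])
    also have "\<dots> = (\<Sum>s\<in>?Q. of_int (sign \<kappa>) * (of_int (sign s) * (\<Prod>i\<in>S. P (s i) i)))"
    proof (rule sum.cong[OF refl], clarsimp)
      fix s assume s: "s permutes S"
      have "(\<Prod>i\<in>S. P (s (\<kappa> i)) (\<kappa> i)) = (\<Prod>i\<in>S. P (s i) i)"
        by (rule prod.reindex_bij_betw[OF permutes_imp_bij[OF k], of "\<lambda>i. P (s i) i"])
      moreover have "sign (s \<circ> \<kappa>) = sign s * sign \<kappa>"
        using S s k by (intro sign_compose) (auto intro: permutes_imp_permutation)
      ultimately show "of_int (sign (s \<circ> \<kappa>)) * (\<Prod>i\<in>S. P (s (\<kappa> i)) (\<kappa> i)) =
          of_int (sign \<kappa>) * (of_int (sign s) * (\<Prod>i\<in>S. P (s i) i))" by simp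
    qed
    finally show ?thesis by (simp add: c_def sum_distrib_left)
  qed
  have noninj: "C \<kappa> = 0" if "\<not> inj_on \<kappa> S" for \<kappa>
  proof -
    from that obtain p q where "p \<in> S" "q \<in> S" "p \<noteq> q" "\<kappa> p = \<kappa> q"
      by (auto simp: inj_on_def)
    then show ?thesis
      unfolding C_def
      using alternating_sum_equal_rows[of S p q "\<lambda>i x. P x (\<kappa> i)" id] S by simp
  qed
  have "(\<Sum>s\<in>?Q. of_int (sign s) * (\<Prod>i\<in>S. \<Sum>k\<in>S. P (s i) k * f i k)) =
      (\<Sum>s\<in>?Q. \<Sum>\<kappa>\<in>S \<rightarrow>\<^sub>E S. (\<Prod>i\<in>S. f i (\<kappa> i)) * (of_int (sign s) * (\<Prod>i\<in>S. P (s i) (\<kappa> i))))"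
    using S by (simp add: prod_sum_PiE prod.distrib sum_distrib_left mult_ac)
  also have "\<dots> = (\<Sum>\<kappa>\<in>S \<rightarrow>\<^sub>E S. (\<Prod>i\<in>S. f i (\<kappa> i)) * C \<kappa>)"
    by (subst sum.swap) (simp add: C_def sum_distrib_left)
  also have "\<dots> = (\<Sum>\<kappa>\<in>{\<kappa> \<in> S \<rightarrow>\<^sub>E S. inj_on \<kappa> S}. (\<Prod>i\<in>S. f i (\<kappa> i)) * C \<kappa>)"
    using S by (intro sum.mono_neutral_right) (auto simp: noninj intro: finite_PiE)
  \<comment> \<open>Injective self-maps of the finite set \<open>S\<close> are permutations. Only
    the convention outside \<open>S\<close> differs: extensional functions are undefined there,
    permutations are the identity.\<close>
  also have "\<dots> = (\<Sum>s\<in>?Q. (\<Prod>i\<in>S. f i (s i)) * C s)"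
  proof (rule sum.reindex_bij_witness[where
        j = "\<lambda>\<kappa> i. if i \<in> S then \<kappa> i else i" and i = "\<lambda>s. restrict s S"])
    fix \<kappa> assume k: "\<kappa> \<in> {\<kappa> \<in> S \<rightarrow>\<^sub>E S. inj_on \<kappa> S}"
    then show "restrict (\<lambda>i. if i \<in> S then \<kappa> i else i) S = \<kappa>"
      by (auto simp: fun_eq_iff PiE_def extensional_def)
    have "bij_betw \<kappa> S S"
      using k S endo_inj_surj[of S \<kappa>] by (auto simp: bij_betw_def)
    then have "bij_betw (\<lambda>i. if i \<in> S then \<kappa> i else i) S S"
      by (subst bij_betw_cong[where g = \<kappa>]) auto
    then show "(\<lambda>i. if i \<in> S then \<kappa> i else i) \<in> ?Q"
      by (auto intro!: bij_imp_permutes)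
    show "(\<Prod>i\<in>S. f i (if i \<in> S then \<kappa> i else i)) * C (\<lambda>i. if i \<in> S then \<kappa> i else i) =
        (\<Prod>i\<in>S. f i (\<kappa> i)) * C \<kappa>"
      unfolding C_def by simp
  next
    fix s assume s: "s \<in> ?Q"
    then show "(\<lambda>i. if i \<in> S then restrict s S i else i) = s"
      by (auto simp: fun_eq_iff permutes_def)
    show "restrict s S \<in> {\<kappa> \<in> S \<rightarrow>\<^sub>E S. inj_on \<kappa> S}"
      using s by (auto simp: permutes_in_image permutes_inj_on intro: inj_onI dest: permutes_inj injD)
  qed
  also have "\<dots> = c * (\<Sum>s\<in>?Q. of_int (sign s) * (\<Prod>i\<in>S. f i (s i)))"
    by (simp add: perm sum_distrib_left mult_ac)
  finally show "(\<Sum>s\<in>?Q. of_int (sign s) * (\<Prod>i\<in>S. \<Sum>k\<in>S. P (s i) k * f i k)) =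
      (\<Sum>s\<in>?Q. of_int (sign s) * (\<Prod>i\<in>S. P (s i) i)) *
      (\<Sum>s\<in>?Q. of_int (sign s) * (\<Prod>i\<in>S. f i (s i)))"
    by (simp add: c_def)
qed

section \<open>Evaluation of polynomials\<close>

definition eval_monom :: "(nat \<Rightarrow> complex) \<Rightarrow> (nat \<Rightarrow>\<^sub>0 nat) \<Rightarrow> complex"
  where "eval_monom x m = (\<Prod>k\<in>Poly_Mapping.keys m. x k ^ Poly_Mapping.lookup m k)"

definition eval_cpoly :: "(nat \<Rightarrow> complex) \<Rightarrow> cpoly \<Rightarrow> complex"
  where "eval_cpoly x p = (\<Sum>m\<in>Poly_Mapping.keys p. Poly_Mapping.lookup p m * eval_monom x m)"

lemma eval_monom_superset:
  assumes "finite K" "Poly_Mapping.keys m \<subseteq> K"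
  shows "eval_monom x m = (\<Prod>k\<in>K. x k ^ Poly_Mapping.lookup m k)"
  unfolding eval_monom_def using assms
  by (intro prod.mono_neutral_left) (auto simp: in_keys_iff)

lemma eval_monom_add: "eval_monom x (m + m') = eval_monom x m * eval_monom x m'"
proof -
  let ?K = "Poly_Mapping.keys m \<union> Poly_Mapping.keys m'"
  have "Poly_Mapping.keys (m + m') \<subseteq> ?K" by (rule Poly_Mapping.keys_add)
  then show ?thesis
    by (simp add: eval_monom_superset[of ?K] lookup_add power_add prod.distrib)
qed

lemma eval_monom_mult: "eval_monom (\<lambda>k. x k * y k) m = eval_monom x m * eval_monom y m"
  by (simp add: eval_monom_def power_mult_distrib prod.distrib)

lemma eval_monom_one [simp]: "eval_monom (\<lambda>_. 1) m = 1"
  by (simp add: eval_monom_def)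

lemma eval_monom_separates:
  assumes "m \<noteq> m'"
  obtains y where "eval_monom y m \<noteq> eval_monom y m'"
proof -
  from assms obtain k where k: "Poly_Mapping.lookup m k \<noteq> Poly_Mapping.lookup m' k"
    by (meson poly_mapping_eqI)
  \<comment> \<open>The value is 2 at a coordinate where the exponents differ and 1 elsewhere, so
    distinct powers of 2 separate the monomials.\<close>
  define y :: "nat \<Rightarrow> complex" where "y = (\<lambda>_. 1)(k := 2)"
  have "eval_monom y l = 2 ^ Poly_Mapping.lookup l k" for l
  proof -
    have "eval_monom y l = (\<Prod>j\<in>insert k (Poly_Mapping.keys l). y j ^ Poly_Mapping.lookup l j)"
      by (rule eval_monom_superset) auto
    also have "\<dots> = (\<Prod>j\<in>{k}. y j ^ Poly_Mapping.lookup l j)"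
      by (rule prod.mono_neutral_right) (auto simp: y_def)
    finally show ?thesis by (simp add: y_def)
  qed
  moreover have "(2::complex) ^ i = 2 ^ j \<Longrightarrow> i = j" for i j :: nat
    using power_inject_exp[of "2::real" i j]
    by (metis norm_numeral norm_power one_less_numeral_iff semiring_norm(76))
  ultimately show ?thesis using that k by metis
qed

text \<open>Monomials are distinct characters of a monoid, so Dedekind's independence argument applies.\<close>

lemma eval_monom_independent:
  assumes "finite M" and "\<And>x. (\<Sum>m\<in>M. c m * eval_monom x m) = 0"
  shows "\<forall>m\<in>M. c m = 0"
  using assms
proof (induction M arbitrary: c rule: finite_induct)
  case (insert m' M)
  let ?F = "\<lambda>x. \<Sum>m\<in>insert m' M. c m * eval_monom x m"
  have zero: "c m * (eval_monom y m - eval_monom y m') = 0" if "m \<in> M" for m y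
  proof -
    have "(\<Sum>m\<in>M. c m * (eval_monom y m - eval_monom y m') * eval_monom x m) =
        ?F (\<lambda>k. y k * x k) - eval_monom y m' * ?F x" for x
      using insert.hyps
      by (simp add: eval_monom_mult algebra_simps sum_subtractf sum_distrib_left)
    then show ?thesis
      using insert.IH[of "\<lambda>m. c m * (eval_monom y m - eval_monom y m')"] insert.prems that by simp
  qed
  have M: "c m = 0" if "m \<in> M" for m
  proof -
    have "m \<noteq> m'" using that insert.hyps by blast
    then obtain y where "eval_monom y m \<noteq> eval_monom y m'" by (rule eval_monom_separates)
    with zero[OF that, of y] show ?thesis by simp
  qed
  have "c m' = 0"
    using insert.prems[of "\<lambda>_. 1"] insert.hyps M by simp
  with M show ?case by simp
qed simp

lemma eval_cpoly_eq_0_imp: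
  assumes "\<And>x. eval_cpoly x p = 0"
  shows "p = 0"
proof -
  have "\<forall>m\<in>Poly_Mapping.keys p. Poly_Mapping.lookup p m = 0"
    using assms unfolding eval_cpoly_def by (intro eval_monom_independent) auto
  then show ?thesis
    by (metis in_keys_iff lookup_zero poly_mapping_eqI)
qed

lemma eval_cpoly_superset:
  assumes "finite K" "Poly_Mapping.keys p \<subseteq> K"
  shows "eval_cpoly x p = (\<Sum>m\<in>K. Poly_Mapping.lookup p m * eval_monom x m)"
  unfolding eval_cpoly_def using assms
  by (intro sum.mono_neutral_left) (auto simp: in_keys_iff)

lemma eval_cpoly_add: "eval_cpoly x (p + q) = eval_cpoly x p + eval_cpoly x q"
proof -
  let ?K = "Poly_Mapping.keys p \<union> Poly_Mapping.keys q"
  have "Poly_Mapping.keys (p + q) \<subseteq> ?K" by (rule Poly_Mapping.keys_add)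
  then show ?thesis
    by (simp add: eval_cpoly_superset[of ?K] lookup_add algebra_simps sum.distrib)
qed

lemma eval_cpoly_0 [simp]: "eval_cpoly x 0 = 0"
  by (simp add: eval_cpoly_def)

lemma eval_cpoly_sum: "eval_cpoly x (sum f K) = (\<Sum>k\<in>K. eval_cpoly x (f k))"
  by (induction K rule: infinite_finite_induct) (simp_all add: eval_cpoly_add)

lemma eval_cpoly_single: "eval_cpoly x (Poly_Mapping.single m c) = c * eval_monom x m"
  by (simp add: eval_cpoly_superset[of "{m}"])

lemma cpoly_eq_sum_single:
  fixes p :: cpoly
  shows "p = (\<Sum>m\<in>Poly_Mapping.keys p. Poly_Mapping.single m (Poly_Mapping.lookup p m))"
  by (rule poly_mapping_eqI)
     (auto simp: lookup_sum lookup_single when_def in_keys_iff)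

lemma eval_cpoly_mult: "eval_cpoly x (p * q) = eval_cpoly x p * eval_cpoly x q"
proof -
  have "p * q = (\<Sum>m\<in>Poly_Mapping.keys p. Poly_Mapping.single m (Poly_Mapping.lookup p m)) *
      (\<Sum>m\<in>Poly_Mapping.keys q. Poly_Mapping.single m (Poly_Mapping.lookup q m))"
    using cpoly_eq_sum_single[of p] cpoly_eq_sum_single[of q] by simp
  also have "eval_cpoly x \<dots> = (\<Sum>m\<in>Poly_Mapping.keys p. \<Sum>l\<in>Poly_Mapping.keys q.
      Poly_Mapping.lookup p m * eval_monom x m * (Poly_Mapping.lookup q l * eval_monom x l))"
    by (simp add: sum_product mult_single eval_cpoly_sum eval_cpoly_single eval_monom_add mult_ac)
  finally show ?thesis
    by (simp add: eval_cpoly_def sum_product)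
qed

lemma eval_cpoly_1: "eval_cpoly x 1 = 1"
  by (simp add: eval_cpoly_single eval_monom_def flip: single_one)

lemma eval_cpoly_prod: "eval_cpoly x (prod f K) = (\<Prod>k\<in>K. eval_cpoly x (f k))"
  by (induction K rule: infinite_finite_induct) (simp_all add: eval_cpoly_mult eval_cpoly_1)

lemma eval_cpoly_Const [simp]: "eval_cpoly x (Const c) = c"
  by (simp add: Const_def eval_cpoly_single eval_monom_def)

lemma eval_cpoly_X [simp]: "eval_cpoly x (X k) = x k"
  by (simp add: X_def eval_cpoly_single eval_monom_def)

lemma eval_hyperdet:
  "eval_cpoly x (hyperdet d n M) = 1 / fact n *
     altsum {1..n} (replicate d id) (\<lambda>ws. \<Prod>i=1..n. eval_cpoly x (M (map (\<lambda>w. w i) ws)))"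
  unfolding hyperdet_eq_altsum
  by (simp add: eval_cpoly_mult altsum_hom[of "eval_cpoly x"] eval_cpoly_add eval_cpoly_1
      eval_cpoly_prod)

section \<open>Alternating sums for matrix units\<close>

abbreviation composable :: "'k \<times> 'k \<Rightarrow> 'k \<times> 'k \<Rightarrow> bool"
  where "composable p q \<equiv> snd p = fst q"

text \<open>For nonempty \<open>I\<close>, this is the coefficient of the matrix unit at position
  \<open>q\<close> in the product of the matrix units at the positions in \<open>I\<close>.\<close>

definition path_coeff :: "'k \<times> 'k \<Rightarrow> ('k \<times> 'k) list \<Rightarrow> real"
  where "path_coeff q I =
    of_bool (successively composable I \<and> fst (hd I) = fst q \<and> snd (last I) = snd q)"

text \<open>For nonempty \<open>I\<close>, this is the trace of that product.\<close>

definition cycle_coeff :: "('k \<times> 'k) list \<Rightarrow> real"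
  where "cycle_coeff I = of_bool (successively composable I \<and> snd (last I) = fst (hd I))"

text \<open>Transposition of matrices reverses products.\<close>

lemma path_coeff_swap:
  assumes "I \<noteq> []"
  shows "path_coeff (prod.swap q) I = path_coeff q (rev (map prod.swap I))"
proof -
  have "successively (\<lambda>x y. fst y = snd x) I = successively composable I"
    by (rule arg_cong[where f = "\<lambda>R. successively R I"]) (auto simp: fun_eq_iff)
  then show ?thesis
    using assms
    by (simp add: path_coeff_def successively_map hd_rev last_rev hd_map last_map conj_ac)
qed

text \<open>\<open>P\<close> holds the positions of the matrix units. The condition outside
  \<open>S\<close> makes transposition agree, as a total function, with precomposition by a
  permutation of \<open>S\<close>, which fixes all other points.\<close>

locale relation_enumeration =
  fixes S :: "'i set" and P :: "('k \<times> 'k) set" and \<phi> :: "'i \<Rightarrow> 'k \<times> 'k"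
  assumes finite_S: "finite S" and bij: "bij_betw \<phi> S P" and sym_P: "sym P" and trans_P: "trans P"
    and swap_outside: "\<And>i. i \<notin> S \<Longrightarrow> prod.swap (\<phi> i) = \<phi> i"
begin

lemma finite_P: "finite P"
  using bij finite_S bij_betw_finite by blast

lemma path_endpoints_in:
  assumes "I \<noteq> []" "set I \<subseteq> P" "successively composable I"
  shows "(fst (hd I), snd (last I)) \<in> P"
  using assms
proof (induction I rule: list_nonempty_induct)
  case (cons p I)
  then have "(fst (hd I), snd (last I)) \<in> P" "p \<in> P" "snd p = fst (hd I)"
    by (auto simp: successively_Cons)
  then show ?case
    using cons.hyps transD[OF trans_P, of "fst p" "snd p" "snd (last I)"] by (cases p) simp
qed simp

text \<open>Under the trace a matrix unit pairs only with its transpose. A product of matrix units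
  is zero or a single matrix unit, so at most one \<open>q\<close> contributes.\<close>

lemma cycle_coeff_append:
  assumes "I \<noteq> []" "J \<noteq> []" "set I \<subseteq> P"
  shows "cycle_coeff (I @ J) = (\<Sum>q\<in>P. path_coeff q I * path_coeff (prod.swap q) J)"
proof -
  let ?q = "(fst (hd I), snd (last I))"
  have "(\<Sum>q\<in>P. path_coeff q I * path_coeff (prod.swap q) J) =
      (\<Sum>q\<in>P. if q = ?q then path_coeff ?q I * path_coeff (prod.swap ?q) J else 0)"
    by (rule sum.cong) (auto simp: path_coeff_def prod_eq_iff)
  also have "\<dots> = (if ?q \<in> P then path_coeff ?q I * path_coeff (prod.swap ?q) J else 0)"
    using finite_P by simp
  also have "\<dots> = cycle_coeff (I @ J)"
    using assms path_endpoints_in[of I]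
    by (auto simp: path_coeff_def cycle_coeff_def successively_append_iff)
  finally show ?thesis ..
qed

text \<open>The trace is the sum of the diagonal coefficients. This leads from a nonzero
  \<open>cycle_altsum h\<close> back to a nonzero \<open>path_altsum h m\<close>.\<close>

lemma cycle_coeff_eq_sum:
  assumes "I \<noteq> []" "set I \<subseteq> P"
  shows "cycle_coeff I = (\<Sum>q\<in>P. of_bool (fst q = snd q) * path_coeff q I)"
proof -
  let ?q = "(fst (hd I), snd (last I))"
  have "(\<Sum>q\<in>P. of_bool (fst q = snd q) * path_coeff q I) =
      (\<Sum>q\<in>P. if q = ?q then of_bool (fst ?q = snd ?q) * path_coeff ?q I else 0)"
    by (rule sum.cong) (auto simp: path_coeff_def prod_eq_iff)
  also have "\<dots> = (if ?q \<in> P then of_bool (fst ?q = snd ?q) * path_coeff ?q I else 0)"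
    using finite_P by simp
  also have "\<dots> = cycle_coeff I"
    using assms path_endpoints_in[of I]
    by (auto simp: path_coeff_def cycle_coeff_def)
  finally show ?thesis ..
qed

text \<open>This is \<open>G\<^sub>h(m)\<close>; \<open>m i\<close> prescribes the matrix unit to be
  obtained from the product with index \<open>i\<close>.\<close>

definition path_altsum :: "nat \<Rightarrow> ('i \<Rightarrow> 'k \<times> 'k) \<Rightarrow> real"
  where "path_altsum h m =
    altsum S (replicate h \<phi>) (\<lambda>ws. \<Prod>i\<in>S. path_coeff (m i) (map (\<lambda>w. w i) ws))"

definition cycle_altsum :: "nat \<Rightarrow> real"
  where "cycle_altsum d =
    altsum S (replicate d \<phi>) (\<lambda>ws. \<Prod>i\<in>S. cycle_coeff (map (\<lambda>w. w i) ws))"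

lemma permuted_family:
  assumes "list_all2 (\<lambda>w v. \<exists>s. s permutes S \<and> w = v \<circ> s) ws (replicate h \<phi>)" "i \<in> S"
  shows "length ws = h" "set (map (\<lambda>w. w i) ws) \<subseteq> P"
proof -
  show "length ws = h"
    using assms list_all2_lengthD by fastforce
  then have "\<exists>s. s permutes S \<and> w = \<phi> \<circ> s" if "w \<in> set ws" for w
    using assms that by (auto simp: list_all2_conv_all_nth in_set_conv_nth)
  moreover have "(\<phi> \<circ> s) i \<in> P" if "s permutes S" for s
    using that assms(2) bij_betwE[OF bij] by (simp add: permutes_in_image)
  ultimately show "set (map (\<lambda>w. w i) ws) \<subseteq> P"
    by fastforce
qed

text \<open>Every factor is cut after \<open>h\<close> letters. Expanding the product of sums yields
  choice functions \<open>m\<close>, and for fixed \<open>m\<close> the first \<open>h\<close> modes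
  separate from the last \<open>k\<close>.\<close>

lemma cycle_altsum_split:
  assumes "h > 0" "k > 0"
  shows "cycle_altsum (h + k) =
    (\<Sum>m\<in>S \<rightarrow>\<^sub>E P. path_altsum h m * path_altsum k (\<lambda>i. prod.swap (m i)))"
proof -
  have "cycle_altsum (h + k) = altsum S (replicate h \<phi>) (\<lambda>ws. altsum S (replicate k \<phi>) (\<lambda>zs.
      \<Prod>i\<in>S. cycle_coeff (map (\<lambda>w. w i) ws @ map (\<lambda>w. w i) zs)))"
    by (simp add: cycle_altsum_def replicate_add altsum_append)
  also have "\<dots> = altsum S (replicate h \<phi>) (\<lambda>ws. altsum S (replicate k \<phi>) (\<lambda>zs. \<Sum>m\<in>S \<rightarrow>\<^sub>E P.
      (\<Prod>i\<in>S. path_coeff (m i) (map (\<lambda>w. w i) ws)) *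
      (\<Prod>i\<in>S. path_coeff (prod.swap (m i)) (map (\<lambda>w. w i) zs))))"
  proof (rule altsum_cong, rule altsum_cong)
    fix ws zs
    assume ws: "list_all2 (\<lambda>w v. \<exists>s. s permutes S \<and> w = v \<circ> s) ws (replicate h \<phi>)"
      and zs: "list_all2 (\<lambda>w v. \<exists>s. s permutes S \<and> w = v \<circ> s) zs (replicate k \<phi>)"
    have "(\<Prod>i\<in>S. cycle_coeff (map (\<lambda>w. w i) ws @ map (\<lambda>w. w i) zs)) =
       (\<Prod>i\<in>S. \<Sum>q\<in>P. path_coeff q (map (\<lambda>w. w i) ws) * path_coeff (prod.swap q) (map (\<lambda>w. w i) zs))"
      using permuted_family[OF ws] permuted_family[OF zs] assms
      by (intro prod.cong refl cycle_coeff_append) auto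
    also have "\<dots> = (\<Sum>m\<in>S \<rightarrow>\<^sub>E P. (\<Prod>i\<in>S. path_coeff (m i) (map (\<lambda>w. w i) ws)) *
      (\<Prod>i\<in>S. path_coeff (prod.swap (m i)) (map (\<lambda>w. w i) zs)))"
      by (simp add: prod_sum_PiE finite_S finite_P prod.distrib)
    finally show "(\<Prod>i\<in>S. cycle_coeff (map (\<lambda>w. w i) ws @ map (\<lambda>w. w i) zs)) = \<dots>" .
  qed
  also have "\<dots> = (\<Sum>m\<in>S \<rightarrow>\<^sub>E P. path_altsum h m * path_altsum k (\<lambda>i. prod.swap (m i)))"
    by (simp add: altsum_sum altsum_mult altsum_mult_right path_altsum_def)
  finally show ?thesis .
qed

lemma cycle_altsum_eq_sum:
  assumes "h > 0"
  shows "cycle_altsum h =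
    (\<Sum>m\<in>S \<rightarrow>\<^sub>E P. (\<Prod>i\<in>S. of_bool (fst (m i) = snd (m i))) * path_altsum h m)"
proof -
  have "cycle_altsum h = altsum S (replicate h \<phi>) (\<lambda>ws. \<Sum>m\<in>S \<rightarrow>\<^sub>E P.
      (\<Prod>i\<in>S. of_bool (fst (m i) = snd (m i))) * (\<Prod>i\<in>S. path_coeff (m i) (map (\<lambda>w. w i) ws)))"
    unfolding cycle_altsum_def
  proof (rule altsum_cong)
    fix ws
    assume ws: "list_all2 (\<lambda>w v. \<exists>s. s permutes S \<and> w = v \<circ> s) ws (replicate h \<phi>)"
    have "(\<Prod>i\<in>S. cycle_coeff (map (\<lambda>w. w i) ws)) =
       (\<Prod>i\<in>S. \<Sum>q\<in>P. of_bool (fst q = snd q) * path_coeff q (map (\<lambda>w. w i) ws))"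
      using permuted_family[OF ws] assms
      by (intro prod.cong refl cycle_coeff_eq_sum) auto
    also have "\<dots> = (\<Sum>m\<in>S \<rightarrow>\<^sub>E P. \<Prod>i\<in>S. of_bool (fst (m i) = snd (m i)) *
        path_coeff (m i) (map (\<lambda>w. w i) ws))"
      by (rule prod_sum_PiE) (simp_all add: finite_S finite_P)
    finally show "(\<Prod>i\<in>S. cycle_coeff (map (\<lambda>w. w i) ws)) = (\<Sum>m\<in>S \<rightarrow>\<^sub>E P.
      (\<Prod>i\<in>S. of_bool (fst (m i) = snd (m i))) * (\<Prod>i\<in>S. path_coeff (m i) (map (\<lambda>w. w i) ws)))"
      by (simp only: prod.distrib)
  qed
  then show ?thesis
    by (simp add: altsum_sum altsum_mult path_altsum_def)
qed

lemma swap_enumeration: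
  obtains \<pi> where "\<pi> permutes S" "prod.swap \<circ> \<phi> = \<phi> \<circ> \<pi>"
proof
  define \<pi> where "\<pi> i = (if i \<in> S then inv_into S \<phi> (prod.swap (\<phi> i)) else i)" for i
  have swP: "prod.swap p \<in> P" if "p \<in> P" for p
    using that sym_P by (cases p) (auto dest: symD)
  have "bij_betw prod.swap P P"
    by (rule bij_betw_byWitness[where f' = prod.swap]) (auto intro: swP simp del: swap_simp)
  then have "bij_betw (inv_into S \<phi> \<circ> (prod.swap \<circ> \<phi>)) S S"
    using bij_betw_trans[OF bij_betw_trans[OF bij] bij_betw_inv_into[OF bij]] by blast
  then have "bij_betw \<pi> S S"
    by (subst bij_betw_cong[where g = "inv_into S \<phi> \<circ> (prod.swap \<circ> \<phi>)"]) (auto simp: \<pi>_def)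
  then show "\<pi> permutes S"
    by (rule bij_imp_permutes) (simp add: \<pi>_def)
  show "prod.swap \<circ> \<phi> = \<phi> \<circ> \<pi>"
  proof
    fix i
    have "\<phi> (inv_into S \<phi> (prod.swap (\<phi> i))) = prod.swap (\<phi> i)" if "i \<in> S"
      using that bij_betwE[OF bij] bij by (intro f_inv_into_f) (simp add: bij_betw_def swP)
    then show "(prod.swap \<circ> \<phi>) i = (\<phi> \<circ> \<pi>) i"
      using swap_outside by (cases "i \<in> S") (auto simp: \<pi>_def)
  qed
qed

text \<open>Transposing the targets amounts to reversing the modes, which changes nothing, and
  transposing the letters, which reindexes every mode by one permutation \<open>\<pi>\<close>. The
  factor \<open>sign \<pi> ^ h\<close> does not depend on \<open>m\<close>, as a sum of squares
  requires.\<close>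

lemma path_altsum_swap:
  obtains \<epsilon> where "\<epsilon> \<noteq> 0"
    and "\<And>m. h > 0 \<Longrightarrow> path_altsum h (\<lambda>i. prod.swap (m i)) = \<epsilon> * path_altsum h m"
proof -
  obtain \<pi> where \<pi>: "\<pi> permutes S" "prod.swap \<circ> \<phi> = \<phi> \<circ> \<pi>"
    by (rule swap_enumeration)
  have "path_altsum h (\<lambda>i. prod.swap (m i)) = of_int (sign \<pi>) ^ h * path_altsum h m" if "h > 0" for m
  proof -
    let ?\<Psi> = "\<lambda>ws. \<Prod>i\<in>S. path_coeff (m i) (map (\<lambda>w. w i) ws)"
    have "path_altsum h (\<lambda>i. prod.swap (m i)) =
        altsum S (replicate h \<phi>) (\<lambda>ws. ?\<Psi> (rev (map ((\<circ>) prod.swap) ws)))"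
      unfolding path_altsum_def
    proof (rule altsum_cong, rule prod.cong[OF refl])
      fix ws i
      assume ws: "list_all2 (\<lambda>w v. \<exists>s. s permutes S \<and> w = v \<circ> s) ws (replicate h \<phi>)" and "i \<in> S"
      then have "map (\<lambda>w. w i) ws \<noteq> []"
        using permuted_family(1)[OF ws] that by auto
      from path_coeff_swap[OF this, of "m i"]
      show "path_coeff (prod.swap (m i)) (map (\<lambda>w. w i) ws) =
          path_coeff (m i) (map (\<lambda>w. w i) (rev (map ((\<circ>) prod.swap) ws)))"
        by (simp add: rev_map comp_def)
    qed
    also have "\<dots> = altsum S (replicate h (\<phi> \<circ> \<pi>)) (\<lambda>ws. ?\<Psi> (rev ws))"
      using altsum_map[of S prod.swap "replicate h \<phi>" "\<lambda>ws. ?\<Psi> (rev ws)"] \<pi>(2) by simp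
    also have "\<dots> = altsum S (replicate h (\<phi> \<circ> \<pi>)) ?\<Psi>"
      using altsum_rev[of S "replicate h (\<phi> \<circ> \<pi>)" ?\<Psi>] by simp
    also have "\<dots> = of_int (sign \<pi>) ^ h * path_altsum h m"
      unfolding path_altsum_def by (rule altsum_replicate_comp_permutation[OF finite_S \<pi>(1)])
    finally show ?thesis .
  qed
  moreover have "of_int (sign \<pi>) ^ h \<noteq> (0::real)"
    by (simp add: sign_def)
  ultimately show thesis using that by blast
qed

text \<open>Cutting the cycle in the middle writes the alternating sum as plus or minus a sum of squares.\<close>

lemma cycle_altsum_double_nonzero:
  assumes "h > 0" and m: "m \<in> S \<rightarrow>\<^sub>E P" "path_altsum h m \<noteq> 0"
  shows "cycle_altsum (2 * h) \<noteq> 0"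
proof -
  obtain \<epsilon> where \<epsilon>: "\<epsilon> \<noteq> 0"
    "\<And>m. h > 0 \<Longrightarrow> path_altsum h (\<lambda>i. prod.swap (m i)) = \<epsilon> * path_altsum h m"
    using path_altsum_swap[of h] by metis
  have "cycle_altsum (2 * h) = \<epsilon> * (\<Sum>m\<in>S \<rightarrow>\<^sub>E P. (path_altsum h m)\<^sup>2)"
    using cycle_altsum_split[of h h] assms
    by (simp add: \<epsilon>(2) mult_2 sum_distrib_left power2_eq_square mult.left_commute)
  \<comment> \<open>The values are real, so a single nonzero square makes the sum positive.\<close>
  moreover have "(\<Sum>m\<in>S \<rightarrow>\<^sub>E P. (path_altsum h m)\<^sup>2) > 0"
    using m by (intro sum_pos2[of _ m]) (auto intro: finite_PiE finite_S finite_P)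
  ultimately show ?thesis using \<epsilon>(1) by simp
qed

text \<open>With one mode and targets \<open>\<phi>\<close>, only the identity permutation meets
  every target.\<close>

lemma path_altsum_one: "path_altsum 1 (restrict \<phi> S) \<noteq> 0"
proof -
  have "(\<Prod>i\<in>S. path_coeff (restrict \<phi> S i) [\<phi> (s i)]) = of_bool (s = id)" if s: "s permutes S" for s
  proof (cases "s = id")
    case False
    then obtain i where "i \<in> S" "s i \<noteq> i"
      using s by (metis eq_id_iff permutes_not_in)
    moreover from this have "\<phi> (s i) \<noteq> \<phi> i"
      using bij s by (metis bij_betw_def inj_onD permutes_in_image)
    ultimately show ?thesis
      using finite_S False by (auto simp: path_coeff_def prod_eq_iff)
  qed (simp add: path_coeff_def)
  then have "path_altsum 1 (restrict \<phi> S) = (\<Sum>s | s permutes S. of_int (sign s) * of_bool (s = id))"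
    by (simp add: path_altsum_def)
  also have "\<dots> = (\<Sum>s\<in>{id :: 'i \<Rightarrow> 'i}. of_int (sign s) * of_bool (s = id))"
    by (rule sum.mono_neutral_right) (auto simp: finite_permutations finite_S permutes_id
        simp del: sum_mult_of_bool_eq)
  finally show ?thesis by simp
qed

text \<open>Strong induction from \<open>k\<close> to \<open>h > 1\<close>, where
  \<open>2 * k\<close> is the even one of \<open>h\<close> and \<open>h + 1\<close>. A nonzero value
  at length \<open>k\<close> makes \<open>cycle_altsum (2 * k)\<close> nonzero, and this sum is a
  linear combination of the values at length \<open>h\<close>.\<close>

lemma path_altsum_nonzero:
  assumes "h > 0"
  shows "\<exists>m\<in>S \<rightarrow>\<^sub>E P. path_altsum h m \<noteq> 0"
  using assms
proof (induction h rule: less_induct)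
  case (less h)
  consider "h = 1" | k where "h = 2 * k" "k > 0" "k < h" | k where "h + 1 = 2 * k" "k > 0" "k < h"
  proof (cases "even h")
    case True
    then show thesis
      using less.prems that(2) by (auto elim!: evenE)
  next
    case False
    then obtain k where "h = 2 * k + 1" by (rule oddE)
    then show thesis
      using that(1) that(3)[of "k + 1"] by (cases "k = 0") auto
  qed
  then show ?case
  proof cases
    case 1
    then show ?thesis
      using path_altsum_one bij_betwE[OF bij]
      by (intro bexI[of _ "restrict \<phi> S"]) (simp_all del: restrict_apply)
  next
    case (2 k)
    then have "cycle_altsum h \<noteq> 0"
      using less.IH[of k] cycle_altsum_double_nonzero[of k] by auto
    then show ?thesis
      using cycle_altsum_eq_sum[OF less.prems] by (metis (no_types, lifting) mult_zero_right sum.neutral)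
  next
    case (3 k)
    then have "cycle_altsum (h + 1) \<noteq> 0"
      using less.IH[of k] cycle_altsum_double_nonzero[of k] by auto
    then show ?thesis
      using cycle_altsum_split[OF less.prems zero_less_one]
      by (metis (no_types, lifting) mult_zero_left sum.neutral)
  qed
qed

lemma cycle_altsum_even_nonzero:
  assumes "even d" "d > 0"
  shows "cycle_altsum d \<noteq> 0"
proof -
  obtain h where "d = 2 * h" "h > 0"
    using assms by (auto elim!: evenE)
  then show ?thesis
    using path_altsum_nonzero[of h] cycle_altsum_double_nonzero[of h] by blast
qed

end

section \<open>Square-zero ideals\<close>

context vector_space
begin

text \<open>Stated for families because vectors may repeat; a repetition gives the relation with
  coefficients 1 and -1.\<close>

lemma family_dependent:
  assumes "finite K" "finite B" "card B < card K" and y: "\<And>i. i \<in> K \<Longrightarrow> y i \<in> span B"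
  shows "\<exists>c. (\<exists>k\<in>K. c k \<noteq> 0) \<and> (\<Sum>i\<in>K. scale (c i) (y i)) = 0"
proof (cases "inj_on y K")
  case False
  then obtain p q where pq: "p \<in> K" "q \<in> K" "p \<noteq> q" "y p = y q"
    by (auto simp: inj_on_def)
  let ?c = "(\<lambda>_. 0)(p := 1, q := - 1)"
  have "(\<Sum>i\<in>K. scale (?c i) (y i)) = (\<Sum>i\<in>{p, q}. scale (?c i) (y i))"
    using pq assms(1) by (intro sum.mono_neutral_right) auto
  also have "\<dots> = 0"
    using pq by simp
  finally show ?thesis
    using pq by (intro exI[of _ ?c]) auto
next
  case True
  have "\<not> independent (y ` K)"
  proof
    assume "independent (y ` K)"
    then have "card (y ` K) \<le> card B"
      using independent_span_bound[of B "y ` K"] assms by blast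
    then show False
      using True assms(3) by (simp add: card_image)
  qed
  then obtain u where u: "\<exists>v\<in>y ` K. u v \<noteq> 0" "(\<Sum>v\<in>y ` K. scale (u v) v) = 0"
    using assms(1) by (auto simp: dependent_finite)
  then show ?thesis
    using True by (intro exI[of _ "u \<circ> y"]) (auto simp: sum.reindex)
qed

lemma in_span_family:
  assumes "finite S" "x \<in> span (v ` S)"
  shows "\<exists>c. x = (\<Sum>k\<in>S. scale (c k) (v k))"
proof -
  \<comment> \<open>\<open>v\<close> may repeat vectors, so one index is kept for each of
    them.\<close>
  obtain U where U: "U \<subseteq> S" "inj_on v U" "v ` S = v ` U"
    using subset_image_inj[of "v ` S" v S] by auto
  have "finite U" using U(1) assms(1) by (rule finite_subset)
  then obtain u where "x = (\<Sum>w\<in>v ` U. scale (u w) w)"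
    using assms(2) U(3) by (auto simp: span_finite)
  also have "\<dots> = (\<Sum>k\<in>U. scale (u (v k)) (v k))"
    using U by (simp add: sum.reindex)
  also have "\<dots> = (\<Sum>k\<in>S. scale (if k \<in> U then u (v k) else 0) (v k))"
    using U assms(1) by (intro sum.mono_neutral_cong_left) auto
  finally show ?thesis by (rule exI[of _ "\<lambda>k. if k \<in> U then u (v k) else 0"])
qed

end

section \<open>Linear functionals and change of basis in a single mode\<close>

context complex_algebra
begin

definition linear_functional :: "('a \<Rightarrow> complex) \<Rightarrow> bool"
  where "linear_functional l \<longleftrightarrow> (\<forall>x y. l (x + y) = l x + l y) \<and> (\<forall>c x. l (scale c x) = c * l x)"

lemma linear_functional_sum:
  assumes "linear_functional l"
  shows "l (\<Sum>k\<in>K. scale (c k) (g k)) = (\<Sum>k\<in>K. c k * l (g k))"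
proof -
  have "l 0 = 0"
    using assms scale_zero_left[of 0] unfolding linear_functional_def by (metis mult_zero_left)
  then show ?thesis
    using assms by (induction K rule: infinite_finite_induct) (auto simp: linear_functional_def)
qed

lemma foldl_mult_sum:
  "foldl (*) (\<Sum>k\<in>K. scale (c k) (g k)) ys = (\<Sum>k\<in>K. scale (c k) (foldl (*) (g k) ys))"
  by (induction ys arbitrary: g) (simp_all add: sum_distrib_right scale_mult_left)

lemma list_product_snoc:
  "xs \<noteq> [] \<Longrightarrow> list_product (xs @ [z]) = list_product xs * z"
  by (cases xs) (simp_all add: list_product_def)

text \<open>Without a unit an empty prefix has no product, hence the case distinction.\<close>

lemma list_product_append_Cons:
  "list_product (xs @ z # ys) = foldl (*) (if xs = [] then z else list_product xs * z) ys"
  by (cases xs) (simp_all add: list_product_def)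

lemma list_product_sum:
  "list_product (xs @ (\<Sum>k\<in>K. scale (c k) (g k)) # ys) =
     (\<Sum>k\<in>K. scale (c k) (list_product (xs @ g k # ys)))"
  by (simp add: list_product_append_Cons foldl_mult_sum sum_distrib_left scale_mult_right)

definition functional_product :: "'i set \<Rightarrow> ('a \<Rightarrow> complex) \<Rightarrow> ('i \<Rightarrow> 'a) list \<Rightarrow> complex"
  where "functional_product S l ws = (\<Prod>i\<in>S. l (list_product (map (\<lambda>w. w i) ws)))"

text \<open>The coordinates of \<open>u\<close> with respect to \<open>v\<close> form a matrix
  \<open>P\<close>, and the sum over the permutation of this mode picks up a factor depending on
  \<open>P\<close> alone, the same for all choices in the other modes.\<close>

lemma altsum_change_one_family:
  assumes S: "finite S" and l: "linear_functional l" and u: "\<And>i. i \<in> S \<Longrightarrow> u i \<in> span (v ` S)"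
  shows "\<exists>c. altsum S (us @ u # vs) (functional_product S l) =
             c * altsum S (us @ v # vs) (functional_product S l)"
proof -
  have "\<forall>i\<in>S. \<exists>c. u i = (\<Sum>k\<in>S. scale (c k) (v k))"
    using u in_span_family[OF S] by blast
  then obtain P where P: "\<And>i. i \<in> S \<Longrightarrow> u i = (\<Sum>k\<in>S. scale (P i k) (v k))"
    by metis
  obtain c where c: "\<And>f. (\<Sum>s | s permutes S. of_int (sign s) * (\<Prod>i\<in>S. \<Sum>k\<in>S. P (s i) k * f i k)) =
           c * (\<Sum>s | s permutes S. of_int (sign s) * (\<Prod>i\<in>S. f i (s i)))"
    using alternating_sum_change_basis[OF S, of P] by blast
  \<comment> \<open>Moves the permutation of the chosen mode into the innermost sum.\<close>
  have slot: "altsum S (us @ w # vs) (functional_product S l) = altsum S us (\<lambda>xs. altsum S vs (\<lambda>ys.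
      \<Sum>s | s permutes S. of_int (sign s) * functional_product S l (xs @ (w \<circ> s) # ys)))" for w
    by (simp add: altsum_append altsum_sum altsum_mult)
  have "(\<Sum>s | s permutes S. of_int (sign s) * functional_product S l (xs @ (u \<circ> s) # ys)) =
      c * (\<Sum>s | s permutes S. of_int (sign s) * functional_product S l (xs @ (v \<circ> s) # ys))" for xs ys
  proof -
    define f where "f i k = l (list_product (map (\<lambda>w. w i) xs @ v k # map (\<lambda>w. w i) ys))" for i k
    have "functional_product S l (xs @ (u \<circ> s) # ys) = (\<Prod>i\<in>S. \<Sum>k\<in>S. P (s i) k * f i k)"
      if "s permutes S" for s
      unfolding functional_product_def
      by (rule prod.cong) (simp_all add: P that permutes_in_image list_product_sum
          linear_functional_sum[OF l] f_def)
    then have "(\<Sum>s | s permutes S. of_int (sign s) * functional_product S l (xs @ (u \<circ> s) # ys)) =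
        (\<Sum>s | s permutes S. of_int (sign s) * (\<Prod>i\<in>S. \<Sum>k\<in>S. P (s i) k * f i k))"
      by simp
    also have "\<dots> = c * (\<Sum>s | s permutes S. of_int (sign s) * (\<Prod>i\<in>S. f i (s i)))"
      by (rule c)
    also have "\<dots> = c * (\<Sum>s | s permutes S. of_int (sign s) * functional_product S l (xs @ (v \<circ> s) # ys))"
      by (simp add: functional_product_def f_def)
    finally show ?thesis .
  qed
  then show ?thesis
    unfolding slot by (auto simp: altsum_mult)
qed

lemma altsum_change_families:
  assumes S: "finite S" and l: "linear_functional l"
    and "list_all2 (\<lambda>u v. \<forall>i\<in>S. u i \<in> span (v ` S)) us vs"
  shows "\<exists>c. altsum S (ws @ us) (functional_product S l) =
             c * altsum S (ws @ vs) (functional_product S l)"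
  using assms(3)
proof (induction us vs arbitrary: ws rule: list_all2_induct)
  case Nil
  show ?case by (rule exI[of _ 1]) simp
next
  case (Cons u us v vs)
  obtain c where "altsum S ((ws @ [u]) @ us) (functional_product S l) =
             c * altsum S ((ws @ [u]) @ vs) (functional_product S l)"
    using Cons.IH by blast
  moreover obtain c' where "altsum S (ws @ u # vs) (functional_product S l) =
             c' * altsum S (ws @ v # vs) (functional_product S l)"
    using altsum_change_one_family[OF S l, of u v ws vs] Cons.hyps by blast
  ultimately show ?case
    by (intro exI[of _ "c * c'"]) simp
qed

section \<open>Square-zero ideals, the radical and semisimplicity\<close>

definition square_zero_ideal :: "'a set \<Rightarrow> bool"
  where "square_zero_ideal I \<longleftrightarrow>
    left_ideal I \<and> (\<forall>x\<in>I. \<forall>y. x * y \<in> I) \<and> (\<forall>x\<in>I. \<forall>y\<in>I. x * y = 0)"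

lemma left_idealD:
  assumes "left_ideal L"
  shows "subspace L" "0 \<in> L" "\<And>x y. y \<in> L \<Longrightarrow> x * y \<in> L"
    "\<And>x y. x \<in> L \<Longrightarrow> y \<in> L \<Longrightarrow> x + y \<in> L" "\<And>x y. x \<in> L \<Longrightarrow> y \<in> L \<Longrightarrow> x - y \<in> L"
    "\<And>c x. x \<in> L \<Longrightarrow> scale c x \<in> L"
  using assms
  by (auto simp: left_ideal_def subspace_0 subspace_add subspace_diff subspace_scale)

text \<open>Right multiplication by \<open>y\<close> is a homomorphism of left modules.\<close>

lemma left_ideal_image_mult:
  assumes "left_ideal L"
  shows "left_ideal ((\<lambda>x. x * y) ` L)"
  unfolding left_ideal_def
proof (intro conjI allI ballI subspaceI)
  note L = left_idealD[OF assms]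
  show "0 \<in> (\<lambda>x. x * y) ` L"
    using L(2) by (intro image_eqI[of _ _ 0]) auto
  fix z assume "z \<in> (\<lambda>x. x * y) ` L"
  then obtain x where x: "x \<in> L" "z = x * y" by blast
  show "z + w \<in> (\<lambda>x. x * y) ` L" if "w \<in> (\<lambda>x. x * y) ` L" for w
    using that x L(4) by (auto simp: distrib_right[symmetric])
  show "scale c z \<in> (\<lambda>x. x * y) ` L" for c
    using x L(6) by (auto simp: scale_mult_left[symmetric])
  show "w * z \<in> (\<lambda>x. x * y) ` L" for w
    using x L(3) by (auto simp: mult.assoc[symmetric])
qed

lemma left_ideal_UNIV: "left_ideal UNIV"
  by (simp add: left_ideal_def)

lemma left_ideal_range_mult: "left_ideal (range (\<lambda>x. x * y))"
  by (rule left_ideal_image_mult[OF left_ideal_UNIV])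

text \<open>If \<open>I\<close> were not inside \<open>L\<close>, maximality would give
  \<open>I + L = A\<close>. Writing the modular unit as \<open>e = i + l\<close> yields
  \<open>x * e = x * l\<close> in \<open>L\<close>, and then \<open>x\<close> lies in
  \<open>L\<close> after all.\<close>

lemma square_zero_ideal_subset_jacobson_radical:
  assumes "square_zero_ideal I"
  shows "I \<subseteq> jacobson_radical"
  unfolding jacobson_radical_def
proof (rule Inter_greatest, clarify)
  fix L x
  assume max: "maximal_left_ideal L" and "modular_left_ideal L" and x: "x \<in> I"
  then obtain e where e: "\<And>x. x - x * e \<in> L"
    unfolding modular_left_ideal_def by blast
  have I: "left_ideal I" and L: "left_ideal L"
    using assms max by (simp_all add: square_zero_ideal_def maximal_left_ideal_def)
  let ?K = "{i + l |i l. i \<in> I \<and> l \<in> L}"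
  have K: "left_ideal ?K"
    unfolding left_ideal_def
    using left_idealD(1,3)[OF I] left_idealD(1,3)[OF L]
    by (auto simp: distrib_left intro!: subspace_sums) blast
  have "L \<subseteq> ?K" using left_idealD(2)[OF I] by force
  then consider "?K = L" | "?K = UNIV"
    using max K unfolding maximal_left_ideal_def by blast
  then show "x \<in> L"
  proof cases
    case 1
    have "x + 0 \<in> ?K" using x left_idealD(2)[OF L] by blast
    with 1 show ?thesis by auto
  next
    case 2
    then obtain i l where il: "e = i + l" "i \<in> I" "l \<in> L" by blast
    then have "x * e = x * l"
      using assms x by (simp add: square_zero_ideal_def distrib_left)
    then have "x * e \<in> L" using il left_idealD(3)[OF L] by simp
    from left_idealD(4)[OF L e[of x] this] show ?thesis by simp
  qed
qed

text \<open>The left ideal \<open>I x\<close> inside \<open>L\<close> is 0 or \<open>L\<close>. In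
  the second case \<open>x = j * x\<close> with \<open>j\<close> in \<open>I\<close>, so
  \<open>i * x = (i * j) * x\<close> vanishes anyway.\<close>

lemma square_zero_ideal_mult_simple:
  assumes "square_zero_ideal I" "simple_left_ideal L" "x \<in> L" "i \<in> I"
  shows "i * x = 0"
proof -
  have I: "left_ideal I" and L: "left_ideal L"
    using assms by (simp_all add: square_zero_ideal_def simple_left_ideal_def)
  let ?K = "(\<lambda>i. i * x) ` I"
  have "left_ideal ?K" by (rule left_ideal_image_mult[OF I])
  moreover have "?K \<subseteq> L" using assms(3) left_idealD(3)[OF L] by blast
  ultimately consider "?K = {0}" | "?K = L"
    using assms(2) unfolding simple_left_ideal_def by blast
  then show ?thesis
  proof cases
    case 1
    then show ?thesis using assms(4) by blast
  next
    case 2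
    then obtain j where "j \<in> I" "x = j * x" using assms(3) by blast
    then have "i * x = (i * j) * x" by (metis mult.assoc)
    then show ?thesis using assms(1,4) \<open>j \<in> I\<close> by (simp add: square_zero_ideal_def)
  qed
qed

text \<open>Multiplication by \<open>I\<close> from the left kills every simple summand, hence also
  the unit, a sum of elements of the summands.\<close>

lemma semisimple_square_zero_ideal:
  assumes semisimple and I: "square_zero_ideal I"
  shows "I = {0}"
proof -
  obtain e m L where e: "\<And>x::'a. e * x = x \<and> x * e = x"
    and L: "\<And>i::nat. i < m \<Longrightarrow> simple_left_ideal (L i)"
    and dec: "\<And>x. \<exists>!c. c \<in> (\<Pi>\<^sub>E i\<in>{..<m}. L i) \<and> x = (\<Sum>i<m. c i)"
    using assms(1) unfolding semisimple_def by blast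
  obtain c where c: "c \<in> (\<Pi>\<^sub>E i\<in>{..<m}. L i)" "e = (\<Sum>i<m. c i)"
    using dec[of e] by blast
  have "x = 0" if "x \<in> I" for x
  proof -
    have "x = (\<Sum>i<m. x * c i)"
      using e[of x] c(2) by (simp add: sum_distrib_left[symmetric])
    also have "\<dots> = 0"
      using square_zero_ideal_mult_simple[OF I L] c(1) that by (intro sum.neutral) auto
    finally show ?thesis .
  qed
  moreover have "0 \<in> I" using I by (simp add: square_zero_ideal_def left_idealD(2))
  ultimately show ?thesis by blast
qed

end

section \<open>Vanishing caused by a square-zero ideal\<close>

sublocale complex_algebra_with_basis \<subseteq> finite_dimensional_vector_space scale "a ` {1..n}"
  by (unfold_locales, simp, rule independent_basis, rule span_basis)

context complex_algebra_with_basis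
begin

lemma dim_algebra: "dim (UNIV :: 'a set) = n"
  using inj_basis by (simp add: card_image)

lemma altsum_square_zero_ideal:
  assumes I: "square_zero_ideal I" "I \<noteq> {0}" and l: "linear_functional l" and d: "d > 2"
  shows "altsum {1..n} (replicate d a) (functional_product {1..n} l) = 0"
proof -
  let ?S = "{1..n}"
  have lI: "left_ideal I" using I by (simp add: square_zero_ideal_def)
  note LI = left_idealD[OF lI]
  obtain B where B: "B \<subseteq> I" "independent B" "I \<subseteq> span B" "card B = dim I"
    by (rule basis_exists)
  obtain C where C: "B \<subseteq> C" "C \<subseteq> UNIV" "independent C" "UNIV \<subseteq> span C"
    by (rule maximal_independent_subset_extend[OF subset_UNIV B(2)])
  have fC: "finite C" using C(3) by (rule finiteI_independent)
  have fB: "finite B" using C(1) fC by (rule finite_subset)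
  have "card C = n"
    using basis_card_eq_dim[of C UNIV] C dim_algebra by simp
  then have "card ?S = card C" by simp
  then obtain b where b: "bij_betw b ?S C"
    by (rule exE[OF finite_same_card_bij[OF finite_atLeastAtMost fC]])
  \<comment> \<open>The indices at which the extended basis \<open>b\<close> runs through the basis
    \<open>B\<close> of \<open>I\<close>.\<close>
  define R where "R = {i \<in> ?S. b i \<in> B}"
  have "bij_betw b R B"
  proof (rule bij_betw_subset[OF b])
    show "b ` R = B"
      using C(1) bij_betw_imp_surj_on[OF b] by (fastforce simp: R_def)
  qed (auto simp: R_def)
  then have cardR: "card R = card B" by (rule bij_betw_same_card)
  have "B \<noteq> {}"
    using B(3) I(2) LI(2) by auto
  then have posB: "card B > 0" using fB by (simp add: card_gt_0_iff)
  have spanb: "span (b ` ?S) = UNIV"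
    using b C(4) by (auto simp: bij_betw_def)
  define \<Phi> where "\<Phi> = functional_product ?S l"
  define rest where "rest = replicate (d - 3) a"
  \<comment> \<open>As \<open>d > 2\<close>, the last mode differs from the first two. It keeps the
    family \<open>a\<close>, while the first two will receive \<open>b\<close>.\<close>
  have d3: "replicate d a = a # a # rest @ [a]"
  proof -
    have "d = Suc (Suc (d - 3 + 1))" using d by simp
    then have "replicate d a = a # a # replicate (d - 3 + 1) a" by (metis replicate_Suc)
    then show ?thesis
      unfolding rest_def by (simp add: replicate_append_same)
  qed
  have "list_all2 (\<lambda>u v. \<forall>i\<in>?S. u i \<in> span (v ` ?S)) (a # a # rest @ [a]) (b # b # rest @ [a])"
    using spanb by (auto simp: list_all2_same intro: span_base)
  from altsum_change_families[OF _ l this, of "[]"]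
  obtain c where c: "altsum ?S (replicate d a) \<Phi> = c * altsum ?S (b # b # rest @ [a]) \<Phi>"
    unfolding \<Phi>_def d3 by auto
  have "altsum ?S (b # b # rest @ [a]) \<Phi> =
      altsum ?S (b # b # rest) (\<lambda>ws. \<Sum>s | s permutes ?S. of_int (sign s) * \<Phi> (ws @ [a \<circ> s]))"
    using altsum_append[of ?S "b # b # rest" "[a]" \<Phi>] by simp
  also have "\<dots> = altsum ?S (b # b # rest) (\<lambda>ws. 0)"
  proof (rule altsum_cong)
    fix ws
    assume "list_all2 (\<lambda>w v. \<exists>s. s permutes ?S \<and> w = v \<circ> s) ws (b # b # rest)"
    then obtain s1 s2 zs where s: "s1 permutes ?S" "s2 permutes ?S"
      and ws: "ws = (b \<circ> s1) # (b \<circ> s2) # zs"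
      by (auto simp: list_all2_Cons2)
    \<comment> \<open>The product of the first \<open>d - 1\<close> entries. In the last mode, row
      \<open>i\<close> is the functional taking \<open>x\<close> to
      \<open>l (y i * x)\<close>.\<close>
    define y where "y i = list_product (map (\<lambda>w. w i) ws)" for i
    have y: "y i = foldl (*) (b (s1 i) * b (s2 i)) (map (\<lambda>w. w i) zs)" for i
      by (simp add: y_def ws list_product_def)
    have foldI: "foldl (*) x xs \<in> I" if "x \<in> I" for x xs
      using that I(1) by (induction xs arbitrary: x) (auto simp: square_zero_ideal_def)
    have fold0: "foldl (*) 0 xs = (0::'a)" for xs
      by (induction xs) simp_all
    have \<Phi>: "\<Phi> (ws @ [a \<circ> s]) = (\<Prod>i\<in>?S. l (y i * a (s i)))" for s
    proof -
      have "map (\<lambda>w. w i) ws \<noteq> []" for i using ws by simp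
      then show ?thesis
        by (simp add: \<Phi>_def functional_product_def list_product_snoc y_def)
    qed
    have lmult: "(\<Sum>i\<in>K. k i * l (y i * x)) = l ((\<Sum>i\<in>K. scale (k i) (y i)) * x)" for K k x
      by (simp add: sum_distrib_right scale_mult_left linear_functional_sum[OF l])
    have l0: "l 0 = 0"
      using linear_functional_sum[OF l, of _ _ "{}"] by simp
    have alt0: "(\<Sum>s | s permutes ?S. of_int (sign s) * (\<Prod>i\<in>?S. l (y i * a (s i)))) = 0"
      if K: "K \<subseteq> ?S" "k \<in> K" "u k \<noteq> 0" "(\<Sum>i\<in>K. scale (u i) (y i)) = 0" for K k u
      using alternating_sum_dependent_rows[of ?S K k u "\<lambda>i x. l (y i * x)" a] K
      by (simp add: lmult l0)
    \<comment> \<open>\<open>K1\<close> and \<open>K2\<close> are the rows whose first, respectively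
      second, entry comes from \<open>B\<close>; each has as many elements as
      \<open>B\<close>.\<close>
    define K1 where "K1 = {i \<in> ?S. s1 i \<in> R}"
    define K2 where "K2 = {i \<in> ?S. s2 i \<in> R}"
    have cardK: "card {i \<in> ?S. s i \<in> R} = card B" if "s permutes ?S" for s
    proof -
      have "bij_betw s {i \<in> ?S. s i \<in> R} R"
        unfolding bij_betw_def
      proof
        show "inj_on s {i \<in> ?S. s i \<in> R}"
          using permutes_inj[OF that] by (rule inj_on_subset) simp
        show "s ` {i \<in> ?S. s i \<in> R} = R"
        proof (intro equalityI subsetI)
          fix r assume "r \<in> R"
          then show "r \<in> s ` {i \<in> ?S. s i \<in> R}"
            using permutes_inverses(1)[OF that, of r] permutes_in_image[OF permutes_inv[OF that], of r]
            by (intro image_eqI[of _ _ "inv s r"]) (auto simp: R_def)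
        qed auto
      qed
      then show ?thesis using cardR by (simp add: bij_betw_same_card)
    qed
    have bR: "b i \<in> I" if "i \<in> R" for i using that B(1) by (auto simp: R_def)
    have "(\<Sum>s | s permutes ?S. of_int (sign s) * (\<Prod>i\<in>?S. l (y i * a (s i)))) = 0"
    \<comment> \<open>A common row is zero because \<open>I I = 0\<close>. If there is none, the
      \<open>2 * card B\<close> elements \<open>y i\<close> with \<open>i\<close> in
      \<open>K1\<close> or \<open>K2\<close> lie in \<open>I\<close> and are dependent.\<close>
    proof (cases "K1 \<inter> K2 = {}")
      case False
      then obtain i where i: "i \<in> K1" "i \<in> K2" by blast
      then have "b (s1 i) * b (s2 i) = 0"
        using bR I(1) unfolding K1_def K2_def square_zero_ideal_def by blast
      then have "y i = 0" by (simp add: y fold0)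
      then show ?thesis
        using i by (intro alt0[of "{i}" i "\<lambda>_. 1"]) (auto simp: K1_def)
    next
      case True
      have fin: "finite (K1 \<union> K2)" by (simp add: K1_def K2_def)
      have "card (K1 \<union> K2) = card B + card B"
        using True fin s cardK by (subst card_Un_disjoint) (simp_all add: K1_def K2_def)
      then have card: "card B < card (K1 \<union> K2)" using posB by simp
      have ySpan: "y i \<in> span B" if "i \<in> K1 \<union> K2" for i
      proof -
        have "b (s1 i) * b (s2 i) \<in> I"
          using that bR I(1) LI(3) by (auto simp: K1_def K2_def square_zero_ideal_def)
        then show ?thesis using foldI B(3) unfolding y by blast
      qed
      obtain u k where "k \<in> K1 \<union> K2" "u k \<noteq> 0" "(\<Sum>i\<in>K1 \<union> K2. scale (u i) (y i)) = 0"
        using family_dependent[of "K1 \<union> K2" B y, OF fin fB card ySpan] by blast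
      then show ?thesis by (intro alt0[of "K1 \<union> K2" k u]) (auto simp: K1_def K2_def)
    qed
    then show "(\<Sum>s | s permutes ?S. of_int (sign s) * \<Phi> (ws @ [a \<circ> s])) = 0"
      by (simp only: \<Phi>)
  qed
  finally show ?thesis using c by (simp add: \<Phi>_def)
qed

end

section \<open>Primitive idempotents\<close>

context complex_algebra
begin

definition primitive_idempotent :: "'a \<Rightarrow> bool"
  where "primitive_idempotent e \<longleftrightarrow> e \<noteq> 0 \<and> e * e = e \<and> simple_left_ideal (range (\<lambda>x. x * e))"

text \<open>The left ideal \<open>A x\<close> lies in \<open>A e\<close> and contains
  \<open>x = f * x\<close>, where \<open>f\<close> stands in for a unit. By minimality it equals
  \<open>A e\<close>, so it contains \<open>e\<close>.\<close>

lemma primitive_idempotent_left_inverse: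
  assumes e: "primitive_idempotent e" and x: "x * e = x" "f * x = x" "x \<noteq> 0"
  shows "\<exists>y. y * x = e"
proof -
  have "range (\<lambda>z. z * x) \<subseteq> range (\<lambda>z. z * e)"
  proof
    fix w assume "w \<in> range (\<lambda>z. z * x)"
    then obtain z where "w = z * x" by blast
    then have "w = (z * x) * e" using x by (simp add: mult.assoc)
    then show "w \<in> range (\<lambda>z. z * e)" by blast
  qed
  moreover have "range (\<lambda>z. z * x) \<noteq> {0}"
  proof
    assume "range (\<lambda>z. z * x) = {0}"
    then have "f * x = 0" by blast
    with x show False by simp
  qed
  ultimately have "range (\<lambda>z. z * x) = range (\<lambda>z. z * e)"
    using e left_ideal_range_mult[of x]
    unfolding primitive_idempotent_def simple_left_ideal_def by metis
  moreover have "e \<in> range (\<lambda>z. z * e)"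
    using e unfolding primitive_idempotent_def by (metis rangeI)
  ultimately have "e \<in> range (\<lambda>z. z * x)" by simp
  then show ?thesis by (metis imageE)
qed

text \<open>
  If a simple left ideal \<open>L\<close> squared to zero, then its left annihilator \<open>Z\<close> would contain \<open>L\<close>, and
  the elements of \<open>Z\<close> killed by \<open>Z\<close> from the left would be a square-zero ideal containing \<open>L\<close>.
\<close>

lemma simple_left_ideal_generator:
  assumes nosq: "\<And>I. square_zero_ideal I \<Longrightarrow> I = {0}" and L: "simple_left_ideal L"
  shows "\<exists>e\<in>L. primitive_idempotent e"
proof -
  have lL: "left_ideal L" and L0: "L \<noteq> {0}"
    and min: "\<And>K. left_ideal K \<Longrightarrow> K \<subseteq> L \<Longrightarrow> K = {0} \<or> K = L"
    using L by (auto simp: simple_left_ideal_def)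
  note LL = left_idealD[OF lL]
  have "\<exists>x\<in>L. \<exists>y\<in>L. x * y \<noteq> 0"
  proof (rule ccontr)
    assume "\<not> ?thesis"
    then have sq: "\<And>x y. x \<in> L \<Longrightarrow> y \<in> L \<Longrightarrow> x * y = 0" by blast
    define Z where "Z = {x. \<forall>y\<in>L. x * y = 0}"
    define I where "I = {x \<in> Z. \<forall>z\<in>Z. z * x = 0}"
    have ZA: "z * x \<in> Z" if "z \<in> Z" for z x
      using that LL(3) by (auto simp: Z_def mult.assoc)
    have AZ: "x * z \<in> Z" if "z \<in> Z" for z x
      using that by (auto simp: Z_def mult.assoc)
    have "subspace I"
      unfolding subspace_def I_def Z_def
      by (auto simp: distrib_left distrib_right scale_mult_left scale_mult_right)
    moreover have "x * y \<in> I" if "y \<in> I" for x y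
      using that AZ ZA by (auto simp: I_def mult.assoc[symmetric])
    moreover have "x * y \<in> I" if "x \<in> I" for x y
      using that ZA by (auto simp: I_def mult.assoc[symmetric])
    ultimately have "square_zero_ideal I"
      by (auto simp: square_zero_ideal_def left_ideal_def I_def)
    then have "I = {0}" by (rule nosq)
    moreover have "L \<subseteq> I"
      using sq by (auto simp: I_def Z_def)
    ultimately show False using L0 LL(2) by blast
  qed
  then obtain x y where xy: "x \<in> L" "y \<in> L" "x * y \<noteq> 0" by blast
  \<comment> \<open>By minimality \<open>L y = L\<close>, so some \<open>e\<close> in
    \<open>L\<close> acts on \<open>y\<close> as a left unit.\<close>
  have "(\<lambda>z. z * y) ` L = L"
  proof -
    have "(\<lambda>z. z * y) ` L \<subseteq> L" using xy LL(3) by blast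
    moreover have "(\<lambda>z. z * y) ` L \<noteq> {0}" using xy by blast
    ultimately show ?thesis using min left_ideal_image_mult[OF lL] by blast
  qed
  then obtain e where e: "e \<in> L" "e * y = y" using xy by (metis imageE)
  \<comment> \<open>The annihilator of \<open>y\<close> in \<open>L\<close> is a proper left
    subideal, hence 0, and it contains \<open>e * e - e\<close>.\<close>
  let ?N = "{z \<in> L. z * y = 0}"
  have "subspace ?N"
    using LL by (auto simp: subspace_def distrib_right scale_mult_left)
  then have "left_ideal ?N"
    using LL by (auto simp: left_ideal_def mult.assoc)
  moreover have "?N \<noteq> L" using xy by blast
  ultimately have "?N = {0}" using min by blast
  moreover have "e * e - e \<in> ?N"
    using e LL by (simp add: left_diff_distrib mult.assoc)
  ultimately have ee: "e * e = e" by simp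
  have e0: "e \<noteq> 0" using e(2) xy(3) by auto
  have "range (\<lambda>x. x * e) \<subseteq> L" using e LL(3) by blast
  moreover have "range (\<lambda>x. x * e) \<noteq> {0}"
    using ee e0 by (metis rangeI singletonD)
  ultimately have "range (\<lambda>x. x * e) = L" using min left_ideal_range_mult by blast
  then have "primitive_idempotent e"
    using L ee e0 by (simp add: primitive_idempotent_def)
  with e(1) show ?thesis by blast
qed

end

context complex_algebra_with_basis
begin

lemma simple_left_ideal_exists:
  assumes "left_ideal K" "K \<noteq> {0}"
  shows "\<exists>L\<subseteq>K. simple_left_ideal L"
proof -
  let ?P = "\<lambda>L. left_ideal L \<and> L \<noteq> {0} \<and> L \<subseteq> K"
  obtain L where L: "?P L" and min: "\<And>M. ?P M \<Longrightarrow> dim L \<le> dim M"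
    using ex_has_least_nat[of ?P K dim] assms by blast
  have "M = {0} \<or> M = L" if "left_ideal M" "M \<subseteq> L" for M
    using that L min[of M] subspace_dim_equal[of M L] unfolding left_ideal_def by (metis subset_trans)
  then have "simple_left_ideal L"
    using L by (simp add: simple_left_ideal_def)
  with L show ?thesis by blast
qed

text \<open>The corner \<open>eAe\<close> is a finite-dimensional division algebra over the complex numbers.\<close>

lemma primitive_idempotent_corner:
  assumes e: "primitive_idempotent e"
  shows "\<exists>c. e * x * e = scale c e"
proof -
  define y where "y = e * x * e"
  have ee: "e * e = e" and e0: "e \<noteq> 0" using e by (auto simp: primitive_idempotent_def)
  have ey: "e * y = y" and ye: "y * e = y"
    by (simp_all add: y_def mult.assoc ee) (simp add: mult.assoc[symmetric] ee)
  \<comment> \<open>Powers of \<open>y\<close> inside the corner; the zeroth power is the corner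
    unit \<open>e\<close>.\<close>
  define v where "v k = ((\<lambda>z. y * z) ^^ k) e" for k
  have v: "v 0 = e" "\<And>k. v (Suc k) = y * v k" by (simp_all add: v_def)
  have ev: "e * v k = v k" for k
    by (cases k) (simp_all add: v ee ey mult.assoc[symmetric])
  \<comment> \<open>\<open>pe p\<close> is the value of the polynomial \<open>p\<close> at
    \<open>y\<close>, taken in the corner.\<close>
  define pe where "pe p = (\<Sum>k\<le>degree p. scale (coeff p k) (v k))" for p
  have pe: "pe p = (\<Sum>k\<le>N. scale (coeff p k) (v k))" if "degree p \<le> N" for p N
    unfolding pe_def using that
    by (intro sum.mono_neutral_left) (auto simp: coeff_eq_0)
  have pe_pCons: "pe (pCons c q) = scale c e + y * pe q" for c q
  proof -
    have "pe (pCons c q) = (\<Sum>k\<le>Suc (degree q). scale (coeff (pCons c q) k) (v k))"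
      by (rule pe) (simp add: degree_pCons_le)
    also have "\<dots> = scale c e + y * pe q"
      by (subst sum.atMost_Suc_shift)
         (simp add: v pe_def sum_distrib_left scale_mult_right)
    finally show ?thesis .
  qed
  have pe_add: "pe (p + q) = pe p + pe q" for p q
  proof -
    let ?N = "max (degree p) (degree q)"
    have "degree (p + q) \<le> ?N" by (rule degree_add_le_max)
    then show ?thesis
      by (simp add: pe[of _ ?N] scale_left_distrib sum.distrib)
  qed
  have pe_smult: "pe (smult c q) = scale c (pe q)" for c q
    by (simp add: pe[of "smult c q" "degree q"] degree_smult_le pe_def scale_sum_right)
  have epe: "e * pe q = pe q" for q
    by (simp add: pe_def sum_distrib_left scale_mult_right ev)
  have factor: "pe ([:- c, 1:] * q) = (y - scale c e) * pe q" for c q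
  proof -
    have "[:- c, 1:] * q = pCons 0 q + smult (- c) q" by simp
    then show ?thesis
      by (simp only: pe_add pe_smult pe_pCons)
         (simp add: left_diff_distrib scale_mult_left epe)
  qed
  \<comment> \<open>A root \<open>z\<close> splits off a linear factor. Either the cofactor already
    annihilates \<open>y\<close>, or \<open>y - z e\<close> cannot have a left inverse and must be
    0.\<close>
  have root: "\<exists>c. y = scale c e" if "p \<noteq> 0" "pe p = 0" for p
    using that
  proof (induction "degree p" arbitrary: p rule: less_induct)
    case less
    show ?case
    proof (cases "degree p = 0")
      case True
      then obtain c where "p = [:c:]" by (rule degree_eq_zeroE)
      with less.prems e0 show ?thesis by (simp add: pe_def v)
    next
      case False
      then obtain z where "poly p z = 0"
        using fundamental_theorem_of_algebra[of p] by (auto simp: constant_degree)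
      then obtain q where q: "p = [:- z, 1:] * q"
        by (auto simp: poly_eq_0_iff_dvd elim: dvdE)
      with less.prems have q0: "q \<noteq> 0" by auto
      have "degree p = Suc (degree q)"
        unfolding q using q0 by (subst degree_mult_eq) auto
      show ?thesis
      proof (cases "pe q = 0")
        case True
        with less.hyps[of q] q0 \<open>degree p = Suc (degree q)\<close> show ?thesis by simp
      next
        case False
        let ?w = "y - scale z e"
        have w: "?w * pe q = 0" using less.prems(2) factor unfolding q by simp
        have "?w = 0"
        proof (rule ccontr)
          assume "?w \<noteq> 0"
          moreover have "?w * e = ?w" "e * ?w = ?w"
            by (simp_all add: left_diff_distrib right_diff_distrib scale_mult_left scale_mult_right ee ey ye)
          ultimately obtain u where "u * ?w = e"
            using primitive_idempotent_left_inverse[OF e, of ?w e] by blast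
          then have "e * pe q = u * (?w * pe q)" by (simp add: mult.assoc[symmetric])
          with w epe False show False by simp
        qed
        then show ?thesis by (intro exI[of _ z]) simp
      qed
    qed
  qed
  \<comment> \<open>The \<open>n + 1\<close> powers are dependent in dimension \<open>n\<close>,
    which provides an annihilating polynomial.\<close>
  have "\<exists>c. (\<exists>k\<in>{..n}. c k \<noteq> 0) \<and> (\<Sum>k\<le>n. scale (c k) (v k)) = 0"
    using inj_basis by (intro family_dependent[of _ "a ` {1..n}"]) (simp_all add: card_image span_basis del: One_nat_def)
  then obtain c k where c: "k \<le> n" "c k \<noteq> 0" "(\<Sum>k\<le>n. scale (c k) (v k)) = 0" by auto
  define p where "p = (\<Sum>i\<le>n. monom (c i) i)"
  have coeff: "coeff p j = (if j \<le> n then c j else 0)" for j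
    by (simp add: p_def coeff_sum)
  have "p \<noteq> 0" using coeff[of k] c by auto
  moreover have "pe p = 0"
  proof -
    have "degree p \<le> n" by (rule degree_le) (simp add: coeff)
    then show ?thesis using c(3) by (simp add: pe coeff)
  qed
  ultimately show ?thesis using root by (simp add: y_def)
qed

definition orthogonal_system :: "nat \<Rightarrow> (nat \<Rightarrow> 'a) \<Rightarrow> bool"
  where "orthogonal_system m e \<longleftrightarrow>
    (\<forall>i<m. primitive_idempotent (e i)) \<and> (\<forall>i<m. \<forall>j<m. i \<noteq> j \<longrightarrow> e i * e j = 0)"

lemma orthogonal_system_mult_sum:
  assumes "orthogonal_system m e" "i < m"
  shows "e i * (\<Sum>j<m. e j) = e i" "(\<Sum>j<m. e j) * e i = e i"
proof -
  have "e i * (\<Sum>j<m. e j) = (\<Sum>j<m. if j = i then e i else 0)"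
    unfolding sum_distrib_left using assms
    by (intro sum.cong) (auto simp: orthogonal_system_def primitive_idempotent_def)
  then show "e i * (\<Sum>j<m. e j) = e i" using assms by simp
  have "(\<Sum>j<m. e j) * e i = (\<Sum>j<m. if j = i then e i else 0)"
    unfolding sum_distrib_right using assms
    by (intro sum.cong) (auto simp: orthogonal_system_def primitive_idempotent_def)
  then show "(\<Sum>j<m. e j) * e i = e i" using assms by simp
qed

text \<open>A minimal left ideal in the left annihilator of \<open>E\<close> gives an idempotent
  \<open>g\<close> with \<open>g * E = 0\<close>, but possibly \<open>E * g \<noteq> 0\<close>. The
  correction \<open>f = g - E * g\<close> is orthogonal to \<open>E\<close> on both sides and
  generates the same left ideal.\<close>

lemma orthogonal_system_extend:
  assumes nosq: "\<And>I. square_zero_ideal I \<Longrightarrow> I = {0}"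
    and e: "orthogonal_system m e" and E: "E = (\<Sum>i<m. e i)" and x: "x * E = 0" "x \<noteq> 0"
  shows "\<exists>f. orthogonal_system (Suc m) (e(m := f)) \<and> f * E = 0"
proof -
  let ?K = "{x. x * E = 0}"
  have "left_ideal ?K"
    by (auto simp: left_ideal_def subspace_def distrib_right scale_mult_left mult.assoc)
  moreover have "?K \<noteq> {0}" using x by blast
  ultimately obtain L where L: "L \<subseteq> ?K" "simple_left_ideal L"
    using simple_left_ideal_exists by blast
  then obtain g where g: "g \<in> L" "primitive_idempotent g"
    using simple_left_ideal_generator[OF nosq] by blast
  have gE: "g * E = 0" and gg: "g * g = g" and g0: "g \<noteq> 0"
    using g L by (auto simp: primitive_idempotent_def)
  have EE: "E * E = E"
    using orthogonal_system_mult_sum[OF e] by (simp add: E sum_distrib_right)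
  define f where "f = g - E * g"
  have fg: "f * g = f" by (simp add: f_def left_diff_distrib mult.assoc gg)
  have gf: "g * f = g" by (simp add: f_def right_diff_distrib mult.assoc[symmetric] gE gg)
  have Ef: "E * f = 0" by (simp add: f_def right_diff_distrib mult.assoc[symmetric] EE)
  have fE: "f * E = 0" by (simp add: f_def left_diff_distrib mult.assoc gE)
  have f0: "f \<noteq> 0" using gf g0 by auto
  have ff: "f * f = f"
    by (metis Ef diff_zero f_def fg gf left_diff_distrib mult.assoc)
  have "range (\<lambda>x. x * f) = range (\<lambda>x. x * g)"
  proof (intro equalityI subsetI)
    fix w assume "w \<in> range (\<lambda>x. x * f)"
    then obtain z where "w = z * f" by blast
    then have "w = (z * f) * g" by (simp add: mult.assoc fg)
    then show "w \<in> range (\<lambda>x. x * g)" by blast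
  next
    fix w assume "w \<in> range (\<lambda>x. x * g)"
    then obtain z where "w = z * g" by blast
    then have "w = (z * g) * f" by (simp add: mult.assoc gf)
    then show "w \<in> range (\<lambda>x. x * f)" by blast
  qed
  then have prim: "primitive_idempotent f"
    using g(2) f0 ff by (simp add: primitive_idempotent_def)
  have orth: "f * e i = 0 \<and> e i * f = 0" if "i < m" for i
  proof -
    have "f * e i = f * E * e i" "e i * f = e i * (E * f)"
      using orthogonal_system_mult_sum[OF e that]
      by (simp_all add: E mult.assoc) (simp add: mult.assoc[symmetric])
    then show ?thesis by (simp add: fE Ef)
  qed
  have "orthogonal_system (Suc m) (e(m := f))"
    using e prim orth unfolding orthogonal_system_def by (auto simp: less_Suc_eq)
  with fE show ?thesis by blast
qed

text \<open>Adding an idempotent \<open>f\<close> shrinks the left annihilator of the sum: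
  \<open>f\<close> belonged to it before, but \<open>f * (E + f) = f\<close> is not 0.\<close>

lemma complete_orthogonal_system_exists:
  assumes nosq: "\<And>I. square_zero_ideal I \<Longrightarrow> I = {0}"
  shows "\<exists>m e. orthogonal_system m e \<and> (\<forall>x. x * (\<Sum>i<m. e i) = 0 \<longrightarrow> x = 0)"
proof -
  have "\<exists>m' e'. orthogonal_system m' e' \<and> (\<forall>x. x * (\<Sum>i<m'. e' i) = 0 \<longrightarrow> x = 0)"
    if "orthogonal_system m e" for m e
    using that
  proof (induction "dim {x. x * (\<Sum>i<m. e i) = 0}" arbitrary: m e rule: less_induct)
    case less
    define E where "E = (\<Sum>i<m. e i)"
    show ?case
    proof (cases "\<exists>x. x * E = 0 \<and> x \<noteq> 0")
      case False
      then show ?thesis using less.prems unfolding E_def by blast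
    next
      case True
      then obtain f where f: "orthogonal_system (Suc m) (e(m := f))" "f * E = 0"
        using orthogonal_system_extend[OF nosq less.prems E_def] by blast
      have sum: "(\<Sum>i<Suc m. (e(m := f)) i) = E + f"
        by (simp add: E_def)
      have ff: "f * f = f" "f \<noteq> 0"
        using f(1) by (auto simp: orthogonal_system_def primitive_idempotent_def)
      have EE: "E * E = E"
        using orthogonal_system_mult_sum[OF less.prems] by (simp add: E_def sum_distrib_right)
      let ?K = "{x. x * E = 0}" and ?K' = "{x. x * (E + f) = 0}"
      have "?K' \<subseteq> ?K"
      proof clarify
        fix x assume "x * (E + f) = 0"
        then have "x * ((E + f) * E) = 0" by (simp add: mult.assoc[symmetric])
        then show "x * E = 0" by (simp add: distrib_right EE f(2))
      qed
      moreover have "f \<in> ?K" "f \<notin> ?K'"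
        using f(2) ff by (simp_all add: distrib_left)
      moreover have "subspace ?K" "subspace ?K'"
        by (auto simp: subspace_def distrib_right scale_mult_left)
      ultimately have "dim ?K' < dim ?K"
        by (intro dim_psubset) (simp add: span_eq_iff[THEN iffD2] psubset_eq, blast)
      then show ?thesis
        using less.hyps[of "e(m := f)" "Suc m"] f(1) unfolding sum E_def by blast
    qed
  qed
  \<comment> \<open>The empty system, with sum 0, starts the extension.\<close>
  from this[of 0] show ?thesis by (simp add: orthogonal_system_def)
qed

text \<open>Completeness applied to \<open>x - x * E\<close> makes \<open>E\<close> a right unit.
  Then \<open>y * x = y * (E * x)\<close> shows that the whole algebra kills
  \<open>{x. E * x = 0}\<close> from the left, so this is a square-zero ideal and vanishes.\<close>

lemma complete_orthogonal_system_unit: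
  assumes nosq: "\<And>I. square_zero_ideal I \<Longrightarrow> I = {0}"
    and e: "orthogonal_system m e" and E: "E = (\<Sum>i<m. e i)"
    and complete: "\<And>x. x * E = 0 \<Longrightarrow> x = 0"
  shows "x * E = x" "E * x = x"
proof -
  have EE: "E * E = E"
    using orthogonal_system_mult_sum[OF e] by (simp add: E sum_distrib_right)
  have right: "x * E = x" for x
  proof -
    have "(x - x * E) * E = 0" by (simp add: left_diff_distrib mult.assoc EE)
    then show ?thesis using complete[of "x - x * E"] by simp
  qed
  then show "x * E = x" .
  let ?R = "{x. E * x = 0}"
  have kill: "y * x = 0" if "x \<in> ?R" for x y
  proof -
    have "y * x = y * (E * x)" using right[of y] by (simp add: mult.assoc[symmetric])
    then show ?thesis using that by simp
  qed
  have "subspace ?R"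
    by (auto simp: subspace_def distrib_left scale_mult_right)
  moreover have "y * x \<in> ?R" if "x \<in> ?R" for x y
    using kill[OF that, of y] by simp
  moreover have "x * y \<in> ?R" if "x \<in> ?R" for x y
    using that by (simp add: mult.assoc[symmetric])
  ultimately have "square_zero_ideal ?R"
    unfolding square_zero_ideal_def left_ideal_def using kill by blast
  then have "?R = {0}" by (rule nosq)
  moreover have "x - E * x \<in> ?R"
    by (simp add: right_diff_distrib mult.assoc[symmetric] EE)
  ultimately show "E * x = x" by simp
qed

end

section \<open>Matrix units\<close>

locale split_algebra = complex_algebra_with_basis scale n a
  for scale :: "complex \<Rightarrow> 'a::ring \<Rightarrow> 'a" and n a +
  fixes m :: nat and e :: "nat \<Rightarrow> 'a"
  assumes system: "orthogonal_system m e"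
    and right_unit: "x * (\<Sum>i<m. e i) = x" and left_unit: "(\<Sum>i<m. e i) * x = x"
begin

lemma e_primitive: "i < m \<Longrightarrow> primitive_idempotent (e i)"
  and e_nonzero: "i < m \<Longrightarrow> e i \<noteq> 0"
  and e_mult_e: "i < m \<Longrightarrow> j < m \<Longrightarrow> e i * e j = (if i = j then e i else 0)"
  using system by (auto simp: orthogonal_system_def primitive_idempotent_def)

lemma peirce_decomposition: "x = (\<Sum>j<m. \<Sum>i<m. e i * x * e j)"
proof -
  have "x = (\<Sum>i<m. e i) * x * (\<Sum>j<m. e j)"
    by (simp only: right_unit left_unit)
  then show ?thesis by (simp add: sum_distrib_left sum_distrib_right)
qed

text \<open>The algebra is the direct sum of the simple left ideals \<open>A (e i)\<close>.
  Orthogonality identifies the component of \<open>x\<close> at \<open>i\<close> as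
  \<open>x * e i\<close>.\<close>

lemma semisimple: semisimple
  unfolding semisimple_def
proof (intro conjI exI allI impI)
  fix x :: 'a
  show "(\<Sum>i<m. e i) * x = x" "x * (\<Sum>i<m. e i) = x"
    by (rule left_unit, rule right_unit)
next
  fix i assume "i < m"
  then show "simple_left_ideal (range (\<lambda>x. x * e i))"
    using e_primitive by (simp add: primitive_idempotent_def)
next
  fix x :: 'a
  show "\<exists>!c. c \<in> (\<Pi>\<^sub>E i\<in>{..<m}. range (\<lambda>x. x * e i)) \<and> x = (\<Sum>i<m. c i)"
  proof (rule ex1I[of _ "\<lambda>i\<in>{..<m}. x * e i"], intro conjI)
    show "x = (\<Sum>i<m. (\<lambda>i\<in>{..<m}. x * e i) i)"
      using right_unit[of x] by (simp add: sum_distrib_left)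
  next
    fix c assume c: "c \<in> (\<Pi>\<^sub>E i\<in>{..<m}. range (\<lambda>x. x * e i)) \<and> x = (\<Sum>i<m. c i)"
    have ce: "c i * e j = (if i = j then c i else 0)" if ij: "i < m" "j < m" for i j
    proof -
      from c ij obtain z where "c i = z * e i" by (auto simp: PiE_iff)
      moreover from this have "c i * e j = z * (e i * e j)" by (simp add: mult.assoc)
      ultimately show ?thesis using e_mult_e[OF ij] by auto
    qed
    have "x * e j = c j" if "j < m" for j
    proof -
      have "x * e j = (\<Sum>i<m. c i * e j)" using c by (simp add: sum_distrib_right)
      also have "\<dots> = (\<Sum>i<m. if i = j then c i else 0)"
        using that by (intro sum.cong) (auto simp: ce)
      finally show ?thesis using that by simp
    qed
    then show "c = (\<lambda>i\<in>{..<m}. x * e i)"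
      using c by (auto simp: fun_eq_iff PiE_def extensional_def)
  qed auto
qed

text \<open>The left annihilator of \<open>e i\<close> is maximal because the quotient by it is the
  simple module \<open>A (e i)\<close>. An element of all these annihilators is killed by the
  unit.\<close>

lemma jacobson_radical_zero: "jacobson_radical = {0}"
proof -
  have M: "maximal_left_ideal {x. x * e i = 0}" if "i < m" for i
    unfolding maximal_left_ideal_def
  proof (intro conjI allI impI)
    let ?M = "{x. x * e i = 0}"
    show "left_ideal ?M"
      by (auto simp: left_ideal_def subspace_def distrib_right scale_mult_left mult.assoc)
    show "?M \<noteq> UNIV"
    proof
      assume "?M = UNIV"
      then have "e i * e i = 0" by blast
      then show False using e_mult_e[OF that that] e_nonzero[OF that] by simp
    qed
    fix K assume K: "left_ideal K \<and> ?M \<subseteq> K"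
    then have lK: "left_ideal K" and MK: "\<And>x. x * e i = 0 \<Longrightarrow> x \<in> K" by auto
    show "K = ?M \<or> K = UNIV"
    proof (cases "K = ?M")
      case False
      then obtain k where k: "k \<in> K" "k * e i \<noteq> 0" using K by blast
      have "(\<lambda>x. x * e i) ` K = range (\<lambda>x. x * e i)"
      proof -
        have "(\<lambda>x. x * e i) ` K \<noteq> {0}" using k by blast
        moreover have "(\<lambda>x. x * e i) ` K \<subseteq> range (\<lambda>x. x * e i)" by blast
        moreover have min: "\<forall>K. left_ideal K \<and> K \<subseteq> range (\<lambda>x. x * e i) \<longrightarrow>
            K = {0} \<or> K = range (\<lambda>x. x * e i)"
          using e_primitive[OF that]
          unfolding primitive_idempotent_def simple_left_ideal_def by (elim conjE)
        ultimately show ?thesis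
          using spec[OF min, of "(\<lambda>x. x * e i) ` K"] left_ideal_image_mult[OF lK, of "e i"] by argo
      qed
      \<comment> \<open>Every \<open>x\<close> differs from an element of \<open>K\<close> by
        something annihilating \<open>e i\<close>, which lies in \<open>K\<close> as well.\<close>
      then have "x * e i \<in> (\<lambda>x. x * e i) ` K" for x by simp
      then have "\<exists>y\<in>K. x * e i = y * e i" for x by (simp only: image_iff)
      moreover have "x \<in> K" if "y \<in> K" "x * e i = y * e i" for x y
      proof -
        have "x - y \<in> K" using that(2) by (intro MK) (simp add: left_diff_distrib)
        from left_idealD(4)[OF lK this that(1)] show ?thesis by simp
      qed
      ultimately show ?thesis by blast
    qed simp
  qed
  have "x = 0" if "x \<in> jacobson_radical" for x
  proof -
    have "x * e i = 0" if i: "i < m" for i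
    proof -
      have "modular_left_ideal {x. x * e i = 0}"
        using M[OF i] modular_left_ideal_unital[OF right_unit]
        unfolding maximal_left_ideal_def by blast
      then have "x \<in> {x. x * e i = 0}"
        using M[OF i] \<open>x \<in> jacobson_radical\<close> unfolding jacobson_radical_def by blast
      then show ?thesis by simp
    qed
    then have "x * (\<Sum>i<m. e i) = 0" by (simp add: sum_distrib_left)
    then show ?thesis using right_unit[of x] by simp
  qed
  moreover have "0 \<in> jacobson_radical"
    unfolding jacobson_radical_def by (auto simp: maximal_left_ideal_def left_idealD(2))
  ultimately show ?thesis by blast
qed

definition corner_coeff :: "nat \<Rightarrow> 'a \<Rightarrow> complex"
  where "corner_coeff i x = (SOME c. e i * x * e i = scale c (e i))"

lemma corner_coeff: "i < m \<Longrightarrow> e i * x * e i = scale (corner_coeff i x) (e i)"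
  unfolding corner_coeff_def by (rule someI_ex) (rule primitive_idempotent_corner[OF e_primitive])

lemma corner_coeff_unique: "i < m \<Longrightarrow> e i * x * e i = scale c (e i) \<Longrightarrow> corner_coeff i x = c"
  using corner_coeff[of i x] e_nonzero[of i] by simp

text \<open>The functional with value \<open>\<delta>\<^sub>i\<^sub>j\<close> on
  \<open>E\<^sub>i\<^sub>j\<close>, defined before matrix units are chosen.\<close>

definition corner_trace :: "'a \<Rightarrow> complex"
  where "corner_trace x = (\<Sum>i<m. corner_coeff i x)"

lemma linear_functional_corner_trace: "linear_functional corner_trace"
proof -
  have "corner_coeff i (x + y) = corner_coeff i x + corner_coeff i y" if "i < m" for i x y
    using that by (intro corner_coeff_unique)
      (simp_all add: distrib_left distrib_right corner_coeff scale_left_distrib)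
  moreover have "corner_coeff i (scale c x) = c * corner_coeff i x" if "i < m" for i c x
    using that by (intro corner_coeff_unique)
      (simp_all add: scale_mult_left scale_mult_right corner_coeff)
  ultimately show ?thesis
    by (simp add: linear_functional_def corner_trace_def sum.distrib sum_distrib_left)
qed

text \<open>Indices are linked when the simple modules \<open>A (e i)\<close> and
  \<open>A (e j)\<close> are isomorphic; the classes correspond to the matrix blocks.\<close>

definition linked :: "(nat \<times> nat) set"
  where "linked = {(i, j). i < m \<and> j < m \<and> (\<exists>x. e i * x * e j \<noteq> 0)}"

text \<open>A nonzero \<open>x\<close> in \<open>e\<^sub>i A e\<^sub>j\<close> has a left inverse
  \<open>y\<close>. The other product \<open>x * y\<close> is a scalar multiple of
  \<open>e i\<close>, and \<open>(x * y) * x = x\<close> forces the scalar to be 1.\<close>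

lemma linked_connect:
  assumes "(i, j) \<in> linked"
  obtains x y where "e i * x = x" "x * e j = x" "e j * y = y" "y * e i = y" "x * y = e i" "y * x = e j"
proof -
  from assms obtain z where ij: "i < m" "j < m" and z: "e i * z * e j \<noteq> 0"
    by (auto simp: linked_def)
  have ee: "e i * e i = e i" "e j * e j = e j" using e_mult_e ij by auto
  define x where "x = e i * z * e j"
  have x: "e i * x = x" "x * e j = x" "x \<noteq> 0"
    using z ee by (simp_all add: x_def mult.assoc) (simp add: mult.assoc[symmetric])
  then obtain w where w: "w * x = e j"
    using primitive_idempotent_left_inverse[OF e_primitive[OF ij(2)]] by blast
  define y where "y = e j * w * e i"
  have y: "e j * y = y" "y * e i = y"
    using ee by (simp_all add: y_def mult.assoc) (simp add: mult.assoc[symmetric])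
  have yx: "y * x = e j"
    using w x ee by (simp add: y_def mult.assoc)
  have "x * y = e i * (x * y) * e i"
    using x y by (metis mult.assoc)
  then have c: "x * y = scale (corner_coeff i (x * y)) (e i)"
    using corner_coeff[OF ij(1), of "x * y"] by simp
  define c where "c = corner_coeff i (x * y)"
  have xy: "x * y = scale c (e i)" using c by (simp only: c_def)
  have "(x * y) * x = x" using yx x by (simp add: mult.assoc)
  then have "scale c x = x" using xy x(1) by (simp add: scale_mult_left)
  then have "scale (c - 1) x = 0" by (simp add: scale_left_diff_distrib)
  then have "c = 1" using x(3) by simp
  then have "x * y = e i" using xy by simp
  with x y yx that show thesis by blast
qed

lemma linked_refl: "i < m \<Longrightarrow> (i, i) \<in> linked"
  unfolding linked_def using e_mult_e[of i i] e_nonzero[of i] by (auto intro!: exI[of _ "e i"])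

lemma linked_sym: "sym linked"
proof (rule symI)
  fix i j assume ij: "(i, j) \<in> linked"
  then obtain x y where xy: "e j * y = y" "y * e i = y" "x * y = e i"
    by (rule linked_connect)
  have "i < m" using ij by (simp add: linked_def)
  then have "e j * y * e i \<noteq> 0" using xy e_nonzero[of i] by auto
  then show "(j, i) \<in> linked" using ij unfolding linked_def by auto
qed

lemma linked_trans: "trans linked"
proof (rule transI)
  fix i j k assume ij: "(i, j) \<in> linked" and jk: "(j, k) \<in> linked"
  obtain x y where xy: "e i * x = x" "y * x = e j"
    using ij by (rule linked_connect)
  obtain x' y' where xy': "e j * x' = x'" "x' * e k = x'" "y' * x' = e k"
    using jk by (rule linked_connect)
  have "k < m" using jk by (simp add: linked_def)
  then have "x' \<noteq> 0" using xy'(3) e_nonzero[of k] by auto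
  moreover have "y * (e i * (x * x') * e k) = x'"
    using xy xy' by (metis mult.assoc)
  ultimately have "e i * (x * x') * e k \<noteq> 0" by auto
  then show "(i, k) \<in> linked" using ij jk unfolding linked_def by auto
qed

lemma finite_linked: "finite linked"
  by (rule finite_subset[of _ "{..<m} \<times> {..<m}"]) (auto simp: linked_def)

text \<open>Each class gets a representative \<open>r i\<close>, joined to \<open>i\<close> by
  mutually inverse \<open>x i\<close> and \<open>y i\<close>, and \<open>E (i, j)\<close> is
  \<open>x i * y j\<close>. These elements span because \<open>y i * w * x j\<close> lies in a
  one-dimensional corner for linked \<open>i\<close> and \<open>j\<close>.\<close>

lemma matrix_units_exist:
  obtains E where
    "\<And>p q. p \<in> linked \<Longrightarrow> q \<in> linked \<Longrightarrow> E p * E q = (if snd p = fst q then E (fst p, snd q) else 0)"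
    "\<And>i. i < m \<Longrightarrow> E (i, i) = e i" "span (E ` linked) = UNIV"
proof -
  define r where "r i = (LEAST j. (i, j) \<in> linked)" for i
  have r: "(i, r i) \<in> linked" if "i < m" for i
    unfolding r_def using linked_refl[OF that] by (rule LeastI)
  have r_eq: "r i = r j" if "(i, j) \<in> linked" for i j
  proof -
    have "(i, k) \<in> linked \<longleftrightarrow> (j, k) \<in> linked" for k
      using that linked_sym linked_trans by (meson symD transD)
    then show ?thesis by (simp add: r_def)
  qed
  have "\<forall>i\<in>{..<m}. \<exists>xy. e i * fst xy = fst xy \<and> fst xy * e (r i) = fst xy \<and> e (r i) * snd xy = snd xy \<and>
      snd xy * e i = snd xy \<and> fst xy * snd xy = e i \<and> snd xy * fst xy = e (r i)"
    using linked_connect[OF r] by (metis fst_conv lessThan_iff snd_conv)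
  then obtain z where z: "\<forall>i\<in>{..<m}. e i * fst (z i) = fst (z i) \<and> fst (z i) * e (r i) = fst (z i) \<and>
      e (r i) * snd (z i) = snd (z i) \<and> snd (z i) * e i = snd (z i) \<and> fst (z i) * snd (z i) = e i \<and>
      snd (z i) * fst (z i) = e (r i)"
    by (rule bchoice[THEN exE])
  define x where "x i = fst (z i)" for i
  define y where "y i = snd (z i)" for i
  have xy: "e i * x i = x i" "x i * e (r i) = x i" "e (r i) * y i = y i" "y i * e i = y i"
    "x i * y i = e i" "y i * x i = e (r i)" if "i < m" for i
    using z that by (auto simp: x_def y_def)
  define E where "E p = x (fst p) * y (snd p)" for p
  have mult: "E p * E q = (if snd p = fst q then E (fst p, snd q) else 0)"
    if pq: "p \<in> linked" "q \<in> linked" for p q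
  proof -
    have lt: "fst p < m" "snd p < m" "fst q < m" "snd q < m" using pq by (auto simp: linked_def)
    have "E p * E q = x (fst p) * (y (snd p) * x (fst q)) * y (snd q)"
      by (simp add: E_def mult.assoc)
    moreover have "y (snd p) * x (fst q) = (if snd p = fst q then e (r (fst p)) else 0)"
    proof (cases "snd p = fst q")
      case True
      have "r (fst p) = r (snd p)" using r_eq[of "fst p" "snd p"] pq by simp
      then show ?thesis using True xy(6)[OF lt(2)] by simp
    next
      case False
      have "y (snd p) * x (fst q) = y (snd p) * (e (snd p) * e (fst q)) * x (fst q)"
        using xy lt by (metis mult.assoc)
      then show ?thesis using False e_mult_e lt by simp
    qed
    ultimately show ?thesis using xy(2)[OF lt(1)] by (simp add: E_def)
  qed
  moreover have "E (i, i) = e i" if "i < m" for i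
    using xy(5)[OF that] by (simp add: E_def)
  moreover have "span (E ` linked) = UNIV"
  proof -
    have "e i * w * e j \<in> span (E ` linked)" if ij: "i < m" "j < m" for i j w
    proof (cases "(i, j) \<in> linked")
      case True
      let ?k = "r i"
      have k: "?k < m" "r j = ?k" using r[OF ij(1)] r_eq[OF True] by (auto simp: linked_def)
      have "e i * w * e j = x i * (y i * w * x j) * y j"
        using xy(5) ij by (metis mult.assoc)
      also have "y i * w * x j = e ?k * (y i * w * x j) * e ?k"
        using xy(2,3) ij k by (metis mult.assoc)
      also have "\<dots> = scale (corner_coeff ?k (y i * w * x j)) (e ?k)"
        by (rule corner_coeff[OF k(1)])
      also have "x i * \<dots> * y j = scale (corner_coeff ?k (y i * w * x j)) (E (i, j))"
        using xy(2)[OF ij(1)] by (simp add: scale_mult_left scale_mult_right E_def)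
      finally show ?thesis using True by (simp add: span_scale span_base)
    next
      case False
      then have "e i * w * e j = 0" using ij by (auto simp: linked_def)
      then show ?thesis by (simp add: span_zero)
    qed
    then have "w \<in> span (E ` linked)" for w
      by (subst peirce_decomposition[of w]) (intro span_sum, simp)
    then show ?thesis by blast
  qed
  ultimately show thesis using that by blast
qed

text \<open>The matrix units form a second basis, so \<open>{1..n}\<close> enumerates them, and the
  sum for this basis is \<open>cycle_altsum d\<close>.\<close>

lemma altsum_nonzero:
  assumes d: "even d" "d > 0"
  shows "altsum {1..n} (replicate d a) (functional_product {1..n} corner_trace) \<noteq> 0"
proof -
  let ?S = "{1..n}"
  obtain E where mult: "\<And>p q. p \<in> linked \<Longrightarrow> q \<in> linked \<Longrightarrow>
      E p * E q = (if snd p = fst q then E (fst p, snd q) else 0)"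
    and diag: "\<And>i. i < m \<Longrightarrow> E (i, i) = e i" and span: "span (E ` linked) = UNIV"
    by (rule matrix_units_exist) blast
  have corner: "e i * E p * e j = (if p = (i, j) then E p else 0)"
    if p: "p \<in> linked" and ij: "i < m" "j < m" for p i j
  proof -
    have "E (i, i) * E p = (if i = fst p then E p else 0)"
      using mult[OF linked_refl[OF ij(1)] p] by simp
    moreover have "E p * E (j, j) = (if snd p = j then E p else 0)"
      using mult[OF p linked_refl[OF ij(2)]] by auto
    ultimately show ?thesis using diag ij by (auto simp: prod_eq_iff)
  qed
  have nz: "E p \<noteq> 0" if p: "p \<in> linked" for p
  proof
    assume "E p = 0"
    moreover have "(snd p, fst p) \<in> linked" using p linked_sym by (metis prod.collapse symD)
    ultimately have "E (fst p, fst p) = 0" using mult[OF p, of "(snd p, fst p)"] by simp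
    moreover have "fst p < m" using p by (auto simp: linked_def)
    ultimately show False using diag e_nonzero by simp
  qed
  have inj: "inj_on E linked"
  proof (rule inj_onI)
    fix p q assume pq: "p \<in> linked" "q \<in> linked" "E p = E q"
    then have "fst p < m" "snd p < m" by (auto simp: linked_def)
    then have "E p = (if q = p then E q else 0)"
      using corner[OF pq(1), of "fst p" "snd p"] corner[OF pq(2), of "fst p" "snd p"] pq(3) by simp
    with nz[OF pq(1)] show "p = q" by (auto split: if_splits)
  qed
  have indep: "independent (E ` linked)"
  proof (rule independent_if_scalars_zero)
    show "finite (E ` linked)" using finite_linked by simp
    fix u w assume u: "(\<Sum>w\<in>E ` linked. scale (u w) w) = 0" and "w \<in> E ` linked"
    then obtain p where p: "p \<in> linked" "w = E p" by blast
    have lt: "fst p < m" "snd p < m" using p by (auto simp: linked_def)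
    have "0 = e (fst p) * (\<Sum>q\<in>linked. scale (u (E q)) (E q)) * e (snd p)"
      using u inj by (simp add: sum.reindex)
    also have "\<dots> = (\<Sum>q\<in>linked. scale (u (E q)) (e (fst p) * E q * e (snd p)))"
      by (simp add: sum_distrib_left sum_distrib_right scale_mult_left scale_mult_right)
    also have "\<dots> = (\<Sum>q\<in>linked. if q = p then scale (u (E q)) (E q) else 0)"
      by (rule sum.cong) (auto simp: corner lt)
    also have "\<dots> = scale (u (E p)) (E p)" using finite_linked p by simp
    finally show "u w = 0" using nz p by simp
  qed
  have "card linked = n"
    using basis_card_eq_dim[of "E ` linked" UNIV] indep span dim_algebra card_image[OF inj] by simp
  then have "card ?S = card linked" by simp
  then obtain \<phi>\<^sub>0 where \<phi>\<^sub>0: "bij_betw \<phi>\<^sub>0 ?S linked"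
    using finite_same_card_bij[OF finite_atLeastAtMost finite_linked] by blast
  \<comment> \<open>The value outside \<open>?S\<close> is a diagonal pair, fixed by swapping as the
    locale demands.\<close>
  define \<phi> where "\<phi> i = (if i \<in> ?S then \<phi>\<^sub>0 i else (0, 0))" for i
  have \<phi>: "bij_betw \<phi> ?S linked"
    using \<phi>\<^sub>0 by (subst bij_betw_cong[where g = \<phi>\<^sub>0]) (simp_all add: \<phi>_def)
  interpret relation_enumeration ?S linked \<phi>
    by unfold_locales (use \<phi> linked_sym linked_trans in \<open>auto simp: \<phi>_def\<close>)
  have path: "list_product (map E I) = (if successively composable I then E (fst (hd I), snd (last I)) else 0)"
    if "I \<noteq> []" "set I \<subseteq> linked" for I
    using that
  proof (induction I rule: rev_nonempty_induct)
    case (single p)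
    then show ?case by (simp add: list_product_def)
  next
    case (snoc p I)
    have prod: "list_product (map E (I @ [p])) = list_product (map E I) * E p"
      using snoc.hyps by (simp add: list_product_snoc)
    show ?case
    proof (cases "successively composable I")
      case True
      then have "(fst (hd I), snd (last I)) \<in> linked"
        using path_endpoints_in[of I] snoc by simp
      with True prod snoc show ?thesis
        by (simp add: mult successively_append_iff)
    next
      case False
      with prod snoc show ?thesis by (simp add: successively_append_iff)
    qed
  qed
  have trace_E: "corner_trace (E p) = of_bool (fst p = snd p)" if p: "p \<in> linked" for p
  proof -
    have "corner_coeff i (E p) = (if i = fst p then of_bool (fst p = snd p) else 0)" if i: "i < m" for i
      using corner[OF p i i] diag[OF i] i by (intro corner_coeff_unique) (auto simp: prod_eq_iff, metis prod.collapse)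
    moreover have "fst p < m" using p by (auto simp: linked_def)
    ultimately show ?thesis by (simp add: corner_trace_def)
  qed
  have trace: "corner_trace (list_product (map E I)) = of_real (cycle_coeff I)"
    if "I \<noteq> []" "set I \<subseteq> linked" for I
  proof -
    have "corner_trace 0 = 0"
      using linear_functional_sum[OF linear_functional_corner_trace, of _ _ "{}"] by simp
    then show ?thesis
      using path[OF that] path_endpoints_in[of I] that trace_E by (auto simp: cycle_coeff_def)
  qed
  have "altsum ?S (replicate d (E \<circ> \<phi>)) (functional_product ?S corner_trace) =
      altsum ?S (replicate d \<phi>) (\<lambda>ws. functional_product ?S corner_trace (map ((\<circ>) E) ws))"
    using altsum_map[of ?S E "replicate d \<phi>"] by simp
  also have "\<dots> = altsum ?S (replicate d \<phi>)
      (\<lambda>ws. of_real (\<Prod>i\<in>?S. cycle_coeff (map (\<lambda>w. w i) ws)))"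
  proof (rule altsum_cong)
    fix ws
    assume ws: "list_all2 (\<lambda>w v. \<exists>s. s permutes ?S \<and> w = v \<circ> s) ws (replicate d \<phi>)"
    have "corner_trace (list_product (map (\<lambda>w. w i) (map ((\<circ>) E) ws))) =
        of_real (cycle_coeff (map (\<lambda>w. w i) ws))" if "i \<in> ?S" for i
      using trace[of "map (\<lambda>w. w i) ws"] permuted_family[OF ws that] d by (auto simp: comp_def)
    then show "functional_product ?S corner_trace (map ((\<circ>) E) ws) =
        of_real (\<Prod>i\<in>?S. cycle_coeff (map (\<lambda>w. w i) ws))"
      by (simp add: functional_product_def)
  qed
  also have "\<dots> = of_real (cycle_altsum d)"
    unfolding cycle_altsum_def by (rule altsum_hom[symmetric]) simp_all
  also have "\<dots> \<noteq> 0" using cycle_altsum_even_nonzero[OF d] by simp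
  finally have nonzero: "altsum ?S (replicate d (E \<circ> \<phi>)) (functional_product ?S corner_trace) \<noteq> 0" .
  \<comment> \<open>Expressing the matrix units in the basis \<open>a\<close> makes the nonzero sum
    a multiple of the sum for \<open>a\<close>.\<close>
  have "list_all2 (\<lambda>u v. \<forall>i\<in>?S. u i \<in> span (v ` ?S)) (replicate d (E \<circ> \<phi>)) (replicate d a)"
    by (simp add: list_all2_conv_all_nth span_basis del: One_nat_def)
  from altsum_change_families[OF finite_atLeastAtMost linear_functional_corner_trace this, of "[]"]
  show ?thesis using nonzero by auto
qed

end

section \<open>Values of the hyperdeterminant and the dichotomy\<close>

context complex_algebra_with_basis
begin

lemma eval_hyperdet_algebra_tensor:
  assumes l: "linear_functional l" and x: "\<And>k. k \<in> {1..n} \<Longrightarrow> x k = l (a k)"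
  shows "eval_cpoly x (hyperdet d n algebra_tensor) =
    1 / fact n * altsum {1..n} (replicate d a) (functional_product {1..n} l)"
proof -
  have "eval_cpoly x (algebra_tensor I) = l (list_product (map a I))" for I
    unfolding algebra_tensor_def list_product_basis linear_functional_sum[OF l]
    by (simp add: eval_cpoly_sum eval_cpoly_mult x)
  then have "eval_cpoly x (hyperdet d n algebra_tensor) = 1 / fact n *
      altsum {1..n} (replicate d id) (\<lambda>ws. functional_product {1..n} l (map ((\<circ>) a) ws))"
    by (simp add: eval_hyperdet functional_product_def comp_def)
  also have "altsum {1..n} (replicate d id) (\<lambda>ws. functional_product {1..n} l (map ((\<circ>) a) ws)) =
      altsum {1..n} (replicate d a) (functional_product {1..n} l)"
    using altsum_map[of "{1..n}" a "replicate d id" "functional_product {1..n} l"]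
    by (simp only: map_replicate comp_id)
  finally show ?thesis .
qed

text \<open>Every choice of values for the indeterminates comes from a functional, so vanishing for
  all functionals yields the zero polynomial.\<close>

lemma linear_functional_exists:
  obtains l where "linear_functional l" "\<And>k. k \<in> {1..n} \<Longrightarrow> x k = l (a k)"
proof
  let ?B = "a ` {1..n}"
  let ?l = "\<lambda>v. \<Sum>k=1..n. representation ?B v (a k) * x k"
  have span: "v \<in> span ?B" for v using span_basis by simp
  show "linear_functional ?l"
    unfolding linear_functional_def
    by (simp only: representation_add[OF independent_basis span span]
        representation_scale[OF independent_basis span] distrib_right sum.distrib sum_distrib_left
        mult.assoc simp_thms)
  show "x k = ?l (a k)" if "k \<in> {1..n}" for k
  proof -
    have "?l (a k) = (\<Sum>j=1..n. if j = k then x j else 0)"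
      using that inj_basis representation_basis[OF independent_basis, of "a k"]
      by (intro sum.cong) (auto simp: inj_on_eq_iff)
    then show ?thesis using that by simp
  qed
qed

lemma hyperdet_eq_0_if_square_zero_ideal:
  assumes "square_zero_ideal I" "I \<noteq> {0}" "d > 2"
  shows "hyperdet d n algebra_tensor = 0"
proof (rule eval_cpoly_eq_0_imp)
  fix x
  obtain l where "linear_functional l" "\<And>k. k \<in> {1..n} \<Longrightarrow> x k = l (a k)"
    using linear_functional_exists[of x] by blast
  then show "eval_cpoly x (hyperdet d n algebra_tensor) = 0"
    using eval_hyperdet_algebra_tensor altsum_square_zero_ideal[OF assms(1,2) _ assms(3)] by simp
qed

text \<open>The existence of a nonzero square-zero ideal decides all three conditions at
  once.\<close>

lemma hyperdet_dichotomy: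
  assumes d: "d > 2" "even d"
  shows "hyperdet d n algebra_tensor = 0 \<and> \<not> semisimple \<and> jacobson_radical \<noteq> {0} \<or>
         hyperdet d n algebra_tensor \<noteq> 0 \<and> semisimple \<and> jacobson_radical = {0}"
proof (cases "\<exists>I. square_zero_ideal I \<and> I \<noteq> {0}")
  case True
  then obtain I where I: "square_zero_ideal I" "I \<noteq> {0}" by blast
  have "0 \<in> I" using I(1) by (simp add: square_zero_ideal_def left_idealD(2))
  then have "jacobson_radical \<noteq> {0}"
    using square_zero_ideal_subset_jacobson_radical[OF I(1)] I(2) by blast
  moreover have "\<not> semisimple" using semisimple_square_zero_ideal I by blast
  ultimately show ?thesis
    using hyperdet_eq_0_if_square_zero_ideal[OF I d(1)] by simp
next
  case False
  then have nosq: "I = {0}" if "square_zero_ideal I" for I using that by blast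
  obtain m e where e: "orthogonal_system m e" and complete: "\<And>x. x * (\<Sum>i<m. e i) = 0 \<Longrightarrow> x = 0"
    using complete_orthogonal_system_exists[OF nosq] by blast
  interpret split_algebra scale n a m e
    by unfold_locales
       (rule e, rule complete_orthogonal_system_unit[OF nosq e refl complete],
         assumption+, rule complete_orthogonal_system_unit[OF nosq e refl complete], assumption+)
  \<comment> \<open>The trace is a point at which the polynomial does not vanish.\<close>
  have "eval_cpoly (\<lambda>k. corner_trace (a k)) (hyperdet d n algebra_tensor) \<noteq> 0"
    using eval_hyperdet_algebra_tensor[OF linear_functional_corner_trace, of "\<lambda>k. corner_trace (a k)"]
      altsum_nonzero d by simp
  then have "hyperdet d n algebra_tensor \<noteq> 0" by auto
  then show ?thesis using semisimple jacobson_radical_zero by simp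
qed

end

theorem theorem1p6:
  fixes scale :: "complex \<Rightarrow> 'a::ring \<Rightarrow> 'a" and n d :: nat and a :: "nat \<Rightarrow> 'a"
  assumes "complex_algebra_with_basis scale n a"
    and "d > 2" and "even d"
  shows "(hyperdet d n (complex_algebra_with_basis.algebra_tensor scale n a) \<noteq> 0
            \<longleftrightarrow> complex_algebra.semisimple scale)
       \<and> (hyperdet d n (complex_algebra_with_basis.algebra_tensor scale n a) = 0
            \<longleftrightarrow> complex_algebra.jacobson_radical scale \<noteq> {0})"
  using complex_algebra_with_basis.hyperdet_dichotomy[OF assms] by blast

end
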